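(* Let $n\ge0$, $0\le k\le n$, $I=\{i_0<\dots<i_k\}\subset\{0,\dots,n\}$. The stellar welding inclusion $i_\star:C_\bullet(\Delta^n)\to C_\bullet(\star_{i_0,\dots,i_k}\Delta^n)$, projection $p_\star:C_\bullet(\star_{i_0,\dots,i_k}\Delta^n)\to C_\bullet(\Delta^n)$ and homotopy $a_\star:C_\bullet(\star_{i_0,\dots,i_k}\Delta^n)\to C_{\bullet+1}(\star_{i_0,\dots,i_k}\Delta^n)$ satisfy $$\partial a_\star+a_\star\partial=1-i_\star p_\star,\qquad a_\star^2=0,\qquad a_\star i_\star=0,\qquad p_\star a_\star=0.$$
   Context: $\Delta^n$ is the $n$-simplex with vertices $e_0,\dots,e_n$. The stellar subdivision $\star_{i_0,\dots,i_k}\Delta^n$ is the simplicial complex with vertices $e_\star,e_0,\dots,e_n$ whose simplices are $[e_{j_0},\dots,e_{j_l}]$ and $[e_\star,e_{j_0},\dots,e_{j_l}]$ for all $J=\{j_0,\dots,j_l\}\subset\{0,\dots,n\}$ with $J\not\supset I$ (in the second type $J=\emptyset$, $l=-1$, is allowed, giving the vertex $e_\star$). $C_\bullet$ denotes oriented simplicial chains with real coefficients (permuting vertices multiplies by the sign of the permutation). A hat over a vertex means omission. For $J=\{j_0<\dots<j_l\}$: $i_\star[e_{j_0},\dots,e_{j_l}]=[e_{j_0},\dots,e_{j_l}]$ if $J\not\supset I$, and $i_\star[e_{j_0},\dots,e_{j_l}]=\sum_{i:\,j_i\in I}(-1)^i[e_\star,e_{j_0},\dots,\widehat{e_{j_i}},\dots,e_{j_l}]$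 if $J\supset I$. For $J\not\supset I$: $p_\star[e_{j_0},\dots,e_{j_l}]=[e_{j_0},\dots,e_{j_l}]$ and $p_\star[e_\star,e_{j_0},\dots,e_{j_l}]=\frac1{k+1}\sum_{\alpha\in I\setminus J}[e_\alpha,e_{j_0},\dots,e_{j_l}]$. For $J\not\supset I$: $a_\star[e_{j_0},\dots,e_{j_l}]=0$; $a_\star[e_\star,e_{j_0},\dots,e_{j_l}]=0$ if $|I\setminus J|=1$, and $a_\star[e_\star,e_{j_0},\dots,e_{j_l}]=-\frac1{k+1}\sum_{\alpha\in I\setminus J}[e_\star,e_\alpha,e_{j_0},\dots,e_{j_l}]$ otherwise. *)

theory Defs
  imports Complex_Main "HOL-Combinatorics.Permutations" "HOL-Library.Function_Algebras"
begin

section \<open>Oriented simplicial chains with real coefficients\<close>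

text \<open>
  An oriented \<open>l\<close>-chain of a simplicial complex \<open>K\<close> (given as its set of nonempty simplices) is
  represented, as is usual, by an alternating function of ordered simplices: the value at a list of
  vertices is the coefficient of the simplex oriented by that list.
\<close>

type_synonym 'v chain = "'v list \<Rightarrow> real"

definition scale :: "real \<Rightarrow> 'v chain \<Rightarrow> 'v chain" (infixr "\<odot>" 75) where
  "r \<odot> c = (\<lambda>ws. r * c ws)"

definition alternating :: "'v chain \<Rightarrow> bool" where
  "alternating c \<longleftrightarrow>
     (\<forall>vs p. p permutes {..<length vs} \<longrightarrow> c (permute_list p vs) = of_int (sign p) * c vs)"

definition ochains :: "nat \<Rightarrow> 'v set set \<Rightarrow> 'v chain set" where
  "ochains l K = {c. alternating c \<and> finite {vs. c vs \<noteq> 0} \<and>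
     (\<forall>vs. c vs \<noteq> 0 \<longrightarrow> length vs = l + 1 \<and> distinct vs \<and> set vs \<in> K)}"

text \<open>
  The oriented simplex \<open>[v\<^sub>0, \<dots>, v\<^sub>l]\<close>. For distinct vertices at most one summand occurs; with a
  repeated vertex the signs cancel and the result is \<open>0\<close>.
\<close>

definition osimplex :: "'v list \<Rightarrow> 'v chain" where
  "osimplex vs = (\<lambda>ws. \<Sum>p | p permutes {..<length vs} \<and> permute_list p vs = ws. of_int (sign p))"

text \<open>
  With totally ordered vertices the oriented simplices \<open>[v\<^sub>0, \<dots>, v\<^sub>l]\<close>, \<open>v\<^sub>0 < \<dots> < v\<^sub>l\<close>, form a
  basis of the chains. The following is the linear extension of a map given on that basis.
\<close>

definition linear_extension :: "('v::linorder list \<Rightarrow> 'w chain) \<Rightarrow> 'v chain \<Rightarrow> 'w chain" where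
  "linear_extension f c = (\<Sum>vs | c vs \<noteq> 0 \<and> sorted_wrt (<) vs. c vs \<odot> f vs)"

definition omit :: "nat \<Rightarrow> 'v list \<Rightarrow> 'v list" where
  "omit i vs = take i vs @ drop (Suc i) vs"

text \<open>The complex is not augmented: vertices have boundary \<open>0\<close>.\<close>

definition boundary :: "'v::linorder chain \<Rightarrow> 'v chain" ("\<partial>") where
  "\<partial> = linear_extension (\<lambda>vs.
     if length vs \<le> 1 then 0 else \<Sum>i<length vs. (-1) ^ i \<odot> osimplex (omit i vs))"

lemma osimplex_permute:
  assumes "q permutes {..<length ws}"
  shows "osimplex vs (permute_list q ws) = of_int (sign q) * osimplex vs ws"
proof (cases "length ws = length vs")
  case True
  then have q: "q permutes {..<length vs}"
    using assms by simp
  have iq: "inv q permutes {..<length vs}"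
    using q by (rule permutes_inv)
  have qq: "permute_list (inv q) (permute_list q us) = us" if "length us = length vs" for us :: "'a list"
    using permute_list_compose[of "inv q" us q] q iq that by (simp add: permutes_inv_o)
  have qq': "permute_list q (permute_list (inv q) us) = us" if "length us = length vs" for us :: "'a list"
    using permute_list_compose[of q us "inv q"] q iq that by (simp add: permutes_inv_o)
  have "osimplex vs (permute_list q ws)
      = (\<Sum>p | p permutes {..<length vs} \<and> permute_list p vs = ws. of_int (sign (p \<circ> q)))"
    unfolding osimplex_def
  proof (rule sum.reindex_bij_witness[where i = "\<lambda>p. p \<circ> q" and j = "\<lambda>p. p \<circ> inv q"])
    fix p
    assume "p \<in> {p. p permutes {..<length vs} \<and> permute_list p vs = permute_list q ws}"
    then show "p \<circ> inv q \<circ> q = p" "p \<circ> inv q \<in> {p. p permutes {..<length vs} \<and> permute_list p vs = ws}"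
        "of_int (sign (p \<circ> inv q \<circ> q)) = (of_int (sign p) :: real)"
      using q iq True permute_list_compose[of "inv q" vs p] qq[of ws]
      by (auto simp: o_assoc[symmetric] permutes_inv_o permutes_compose)
  next
    fix p
    assume "p \<in> {p. p permutes {..<length vs} \<and> permute_list p vs = ws}"
    then show "p \<circ> q \<circ> inv q = p"
        "p \<circ> q \<in> {p. p permutes {..<length vs} \<and> permute_list p vs = permute_list q ws}"
      using q iq permute_list_compose[of q vs p]
      by (auto simp: o_assoc[symmetric] permutes_inv_o permutes_compose)
  qed
  also have "\<dots> = (\<Sum>p | p permutes {..<length vs} \<and> permute_list p vs = ws. of_int (sign q) * of_int (sign p))"
  proof (rule sum.cong[OF refl])
    fix p
    assume "p \<in> {p. p permutes {..<length vs} \<and> permute_list p vs = ws}"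
    then have "permutation p" "permutation q"
      using q by (auto simp: permutation_permutes)
    then show "of_int (sign (p \<circ> q)) = (of_int (sign q) * of_int (sign p) :: real)"
      by (simp add: sign_compose)
  qed
  also have "\<dots> = of_int (sign q) * osimplex vs ws"
    by (simp add: osimplex_def sum_distrib_left)
  finally show ?thesis .
next
  case False
  have none: "{p. p permutes {..<length vs} \<and> permute_list p vs = us} = {}"
    if "length us \<noteq> length vs" for us :: "'a list"
    using that by auto
  show ?thesis
    using False by (simp only: osimplex_def none length_permute_list sum.empty not_False_eq_True mult_zero_right)
qed

lemma osimplex_self:
  assumes "distinct vs"
  shows "osimplex vs vs = 1"
proof -
  have "p = id" if p: "p permutes {..<length vs}" and eq: "permute_list p vs = vs" for p
  proof
    fix i
    show "p i = id i"
    proof (cases "i < length vs")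
      case True
      then have "vs ! p i = vs ! i" "p i < length vs"
        using permute_list_nth[OF p True] eq permutes_in_image[OF p, of i] by auto
      with True assms show ?thesis
        by (simp add: nth_eq_iff_index_eq)
    qed (use p in \<open>auto simp: permutes_def\<close>)
  qed
  then have "{p. p permutes {..<length vs} \<and> permute_list p vs = vs} = {id}"
    by (auto simp: permutes_id)
  then show ?thesis
    by (simp add: osimplex_def)
qed

lemma linear_extension_osimplex:
  assumes "sorted_wrt (<) vs"
  shows "linear_extension f (osimplex vs) = f vs"
proof -
  have "ws = vs" if nz: "osimplex vs ws \<noteq> 0" and ws: "sorted_wrt (<) ws" for ws
  proof -
    have "\<exists>p. p permutes {..<length vs} \<and> permute_list p vs = ws"
    proof (rule ccontr)
      assume "\<not> ?thesis"
      then have "{p. p permutes {..<length vs} \<and> permute_list p vs = ws} = {}"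
        by auto
      with nz show False
        by (simp add: osimplex_def)
    qed
    then have "set ws = set vs"
      by (metis mset_permute_list set_mset_mset)
    with ws assms show ?thesis
      by (simp add: strict_sorted_equal)
  qed
  moreover have self: "osimplex vs vs = 1"
    using assms by (intro osimplex_self) (simp add: strict_sorted_iff)
  ultimately have "{ws. osimplex vs ws \<noteq> 0 \<and> sorted_wrt (<) ws} = {vs}"
    using assms by auto
  then show ?thesis
    by (simp add: linear_extension_def self scale_def)
qed


section \<open>The simplex and its stellar subdivision\<close>

datatype vertex = Star ("e\<^sub>\<star>") | E nat

text \<open>The order \<open>e\<^sub>\<star> < e\<^sub>0 < e\<^sub>1 < \<dots>\<close>\<close>

instantiation vertex :: linorder
begin

fun less_eq_vertex :: "vertex \<Rightarrow> vertex \<Rightarrow> bool" where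
  "Star \<le> w \<longleftrightarrow> True"
| "E i \<le> Star \<longleftrightarrow> False"
| "E i \<le> E j \<longleftrightarrow> i \<le> j"

definition less_vertex :: "vertex \<Rightarrow> vertex \<Rightarrow> bool" where
  "v < w \<longleftrightarrow> v \<le> w \<and> \<not> w \<le> (v :: vertex)"

instance
proof
  fix u v w :: vertex
  show "v < w \<longleftrightarrow> v \<le> w \<and> \<not> w \<le> v"
    by (rule less_vertex_def)
  show "v \<le> v"
    by (cases v) auto
  show "u \<le> w" if "u \<le> v" "v \<le> w"
    using that by (cases u; cases v; cases w) auto
  show "v = w" if "v \<le> w" "w \<le> v"
    using that by (cases v; cases w) auto
  show "v \<le> w \<or> w \<le> v"
    by (cases v; cases w) auto
qed

end

definition std_simplex :: "nat \<Rightarrow> vertex set set" ("\<Delta>") where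
  "\<Delta> n = {E ` J |J. J \<subseteq> {0..n} \<and> J \<noteq> {}}"

definition stellar :: "nat set \<Rightarrow> nat \<Rightarrow> vertex set set" where
  "stellar I n = {E ` J |J. J \<subseteq> {0..n} \<and> J \<noteq> {} \<and> \<not> I \<subseteq> J}
               \<union> {insert e\<^sub>\<star> (E ` J) |J. J \<subseteq> {0..n} \<and> \<not> I \<subseteq> J}"


section \<open>Welding inclusion, projection and homotopy\<close>

text \<open>
  Below, \<open>vs\<close> is an increasing list \<open>[E j\<^sub>0, \<dots>, E j\<^sub>l]\<close>, so that \<open>E \<alpha> \<notin> set vs\<close> means \<open>\<alpha> \<notin> J\<close>, and
  \<open>card I\<close> is \<open>k + 1\<close>.
\<close>

definition weld_incl :: "nat set \<Rightarrow> vertex chain \<Rightarrow> vertex chain" ("i\<^sub>\<star>") where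
  "i\<^sub>\<star> I = linear_extension (\<lambda>vs.
     if E ` I \<subseteq> set vs
     then \<Sum>i | i < length vs \<and> vs ! i \<in> E ` I. (-1) ^ i \<odot> osimplex (e\<^sub>\<star> # omit i vs)
     else osimplex vs)"

fun weld_proj_basis :: "nat set \<Rightarrow> vertex list \<Rightarrow> vertex chain" where
  "weld_proj_basis I (Star # vs) =
     (1 / real (card I)) \<odot> (\<Sum>\<alpha> | \<alpha> \<in> I \<and> E \<alpha> \<notin> set vs. osimplex (E \<alpha> # vs))"
| "weld_proj_basis I vs = osimplex vs"

definition weld_proj :: "nat set \<Rightarrow> vertex chain \<Rightarrow> vertex chain" ("p\<^sub>\<star>") where
  "p\<^sub>\<star> I = linear_extension (weld_proj_basis I)"

fun weld_htpy_basis :: "nat set \<Rightarrow> vertex list \<Rightarrow> vertex chain" where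
  "weld_htpy_basis I (Star # vs) =
     (if card {\<alpha> \<in> I. E \<alpha> \<notin> set vs} = 1 then 0
      else (- 1 / real (card I)) \<odot> (\<Sum>\<alpha> | \<alpha> \<in> I \<and> E \<alpha> \<notin> set vs. osimplex (e\<^sub>\<star> # E \<alpha> # vs)))"
| "weld_htpy_basis I vs = 0"

definition weld_htpy :: "nat set \<Rightarrow> vertex chain \<Rightarrow> vertex chain" ("a\<^sub>\<star>") where
  "a\<^sub>\<star> I = linear_extension (weld_htpy_basis I)"

end

theory Submission
  imports Defs
begin

text \<open>
  All maps are linear, so every identity can be checked on oriented simplices, and only simplices
  \<open>[e\<^sub>\<star>, J]\<close> need work. In \<open>a\<^sub>\<star> \<partial> [e\<^sub>\<star>, J]\<close> a face omitting \<open>j \<in> I\<close> may have \<open>j\<close> put back, which after moving it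
  to its old place gives \<open>[e\<^sub>\<star>, J]\<close> itself, \<open>|I \<inter> J|\<close> times in total; in
  \<open>\<partial> a\<^sub>\<star> [e\<^sub>\<star>, J]\<close> the faces that drop the newly inserted vertex contribute the remaining \<open>|I - J|\<close> copies, and the
  other terms cancel or make up \<open>i\<^sub>\<star> p\<^sub>\<star>\<close>. When \<open>|I - J| = 1\<close> the homotopy vanishes on \<open>[e\<^sub>\<star>, J]\<close>, but then \<open>i\<^sub>\<star>\<close>
  subdivides \<open>p\<^sub>\<star> [e\<^sub>\<star>, J]\<close> and supplies the missing copy. The vanishing of \<open>a\<^sub>\<star> a\<^sub>\<star>\<close> and \<open>p\<^sub>\<star> a\<^sub>\<star>\<close> is antisymmetry
  in the two inserted vertices.
\<close>

section \<open>Finitely supported functions of lists and linear extensions\<close>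

global_interpretation chain: vector_space "scale :: real \<Rightarrow> 'v chain \<Rightarrow> 'v chain"
  by unfold_locales (auto simp: scale_def fun_eq_iff algebra_simps)

lemma sum_chain_apply: "(\<Sum>x\<in>A. f x) ws = (\<Sum>x\<in>A. (f x :: 'v chain) ws)"
  by (induction A rule: infinite_finite_induct) auto

text \<open>Additivity of \<open>linear_extension\<close> needs finite support, since a sum over an
  infinite set defaults to 0. The notion mentions neither degree nor complex, so calculations need
  not track them.\<close>

definition fin_supp :: "'v chain \<Rightarrow> bool" where
  "fin_supp c \<longleftrightarrow> finite {vs. c vs \<noteq> 0}"

lemma fin_supp_0 [simp]: "fin_supp 0"
  by (simp add: fin_supp_def)

lemma fin_supp_add [simp]: "fin_supp c \<Longrightarrow> fin_supp d \<Longrightarrow> fin_supp (c + d)"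
  unfolding fin_supp_def
  by (rule finite_subset[of _ "{vs. c vs \<noteq> 0} \<union> {vs. d vs \<noteq> 0}"]) auto

lemma fin_supp_scale [simp]: "fin_supp c \<Longrightarrow> fin_supp (r \<odot> c)"
  unfolding fin_supp_def scale_def
  by (rule finite_subset[of _ "{vs. c vs \<noteq> 0}"]) auto

lemma fin_supp_uminus [simp]: "fin_supp c \<Longrightarrow> fin_supp (- c)"
  by (simp add: fin_supp_def)

lemma fin_supp_diff [simp]: "fin_supp c \<Longrightarrow> fin_supp d \<Longrightarrow> fin_supp (c - d)"
  using fin_supp_add[of c "- d"] by simp

lemma fin_supp_sum [simp]: "(\<And>x. x \<in> A \<Longrightarrow> fin_supp (f x)) \<Longrightarrow> fin_supp (\<Sum>x\<in>A. f x)"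
  by (induction A rule: infinite_finite_induct) auto

lemma fin_supp_linear_extension [simp]: "(\<And>vs. fin_supp (f vs)) \<Longrightarrow> fin_supp (linear_extension f c)"
  by (simp add: linear_extension_def)

text \<open>A common index set for several chains lets their extensions be compared term by
  term.\<close>

lemma linear_extension_superset:
  assumes "finite S" "\<And>vs. c vs \<noteq> 0 \<Longrightarrow> sorted_wrt (<) vs \<Longrightarrow> vs \<in> S" "\<And>vs. vs \<in> S \<Longrightarrow> sorted_wrt (<) vs"
  shows "linear_extension f c = (\<Sum>vs\<in>S. c vs \<odot> f vs)"
  unfolding linear_extension_def
  using assms by (intro sum.mono_neutral_left) auto

lemma linear_extension_scale:
  assumes "fin_supp c"
  shows "linear_extension f (r \<odot> c) = r \<odot> linear_extension f c"
proof -
  define S where "S = {vs. c vs \<noteq> 0 \<and> sorted_wrt (<) vs}"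
  have S: "finite S"
    using assms by (auto simp: S_def fin_supp_def)
  have "linear_extension f (r \<odot> c) = (\<Sum>vs\<in>S. (r \<odot> c) vs \<odot> f vs)"
    by (rule linear_extension_superset[OF S]) (auto simp: S_def scale_def)
  also have "\<dots> = r \<odot> (\<Sum>vs\<in>S. c vs \<odot> f vs)"
    by (simp add: chain.scale_sum_right) (simp add: scale_def mult.assoc)
  finally show ?thesis
    by (simp add: S_def linear_extension_def)
qed

lemma linear_extension_add:
  assumes "fin_supp c" "fin_supp d"
  shows "linear_extension f (c + d) = linear_extension f c + linear_extension f d"
proof -
  define S where "S = {vs. (c vs \<noteq> 0 \<or> d vs \<noteq> 0) \<and> sorted_wrt (<) vs}"
  have S: "finite S"
    using assms unfolding S_def fin_supp_def
    by (auto intro: finite_subset[of _ "{vs. c vs \<noteq> 0} \<union> {vs. d vs \<noteq> 0}"])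
  have "linear_extension f (c + d) = (\<Sum>vs\<in>S. (c + d) vs \<odot> f vs)"
       "linear_extension f c = (\<Sum>vs\<in>S. c vs \<odot> f vs)"
       "linear_extension f d = (\<Sum>vs\<in>S. d vs \<odot> f vs)"
    by (rule linear_extension_superset[OF S]; auto simp: S_def)+
  then show ?thesis
    by (simp add: chain.scale_left_distrib sum.distrib)
qed

lemma linear_extension_0 [simp]: "linear_extension f 0 = 0"
  by (simp add: linear_extension_def)

lemma linear_extension_uminus: "fin_supp c \<Longrightarrow> linear_extension f (- c) = - linear_extension f c"
  using linear_extension_scale[of c f "-1"] by simp

lemma linear_extension_diff:
  "fin_supp c \<Longrightarrow> fin_supp d \<Longrightarrow> linear_extension f (c - d) = linear_extension f c - linear_extension f d"
  using linear_extension_add[of c "- d" f] by (simp add: linear_extension_uminus)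

lemma linear_extension_sum:
  "(\<And>x. x \<in> A \<Longrightarrow> fin_supp (g x)) \<Longrightarrow>
    linear_extension f (\<Sum>x\<in>A. g x) = (\<Sum>x\<in>A. linear_extension f (g x))"
  by (induction A rule: infinite_finite_induct) (auto simp: linear_extension_add)


section \<open>Oriented simplices and the chain groups\<close>

lemma osimplex_nonzeroD: "osimplex vs ws \<noteq> 0 \<Longrightarrow> \<exists>p. p permutes {..<length vs} \<and> permute_list p vs = ws"
  unfolding osimplex_def using sum.not_neutral_contains_not_neutral by fastforce

lemma fin_supp_osimplex [simp]: "fin_supp (osimplex vs)"
  unfolding fin_supp_def
proof (rule finite_subset)
  show "{ws. osimplex vs ws \<noteq> 0} \<subseteq> (\<lambda>p. permute_list p vs) ` {p. p permutes {..<length vs}}"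
    using osimplex_nonzeroD by fastforce
qed (simp add: finite_permutations)

text \<open>Here the vertices are permuted, whereas \<open>osimplex_permute\<close> permutes the
  argument; the sum is reindexed by p \<mapsto> q \<circ> p.\<close>

lemma osimplex_permute_list:
  assumes q: "q permutes {..<length vs}"
  shows "osimplex (permute_list q vs) = of_int (sign q) \<odot> osimplex vs"
proof
  fix ws
  have iq: "inv q permutes {..<length vs}"
    using q by (rule permutes_inv)
  have "osimplex (permute_list q vs) ws
      = (\<Sum>p | p permutes {..<length vs} \<and> permute_list p vs = ws. of_int (sign (inv q \<circ> p)))"
    unfolding osimplex_def
    by (rule sum.reindex_bij_witness[where i = "\<lambda>p. inv q \<circ> p" and j = "\<lambda>p. q \<circ> p"])
      (use q iq in \<open>auto simp: o_assoc permutes_inv_o permutes_compose permute_list_compose\<close>,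
       simp add: permute_list_compose[symmetric] o_assoc permutes_inv_o)
  also have "\<dots> = (\<Sum>p | p permutes {..<length vs} \<and> permute_list p vs = ws. of_int (sign q) * of_int (sign p))"
  proof (rule sum.cong[OF refl])
    fix p
    assume "p \<in> {p. p permutes {..<length vs} \<and> permute_list p vs = ws}"
    then have "permutation p" "permutation q"
      using q by (auto simp: permutation_permutes)
    then show "of_int (sign (inv q \<circ> p)) = (of_int (sign q) * of_int (sign p) :: real)"
      by (simp add: sign_compose sign_inverse permutation_inverse)
  qed
  also have "\<dots> = (of_int (sign q) \<odot> osimplex vs) ws"
    by (simp add: osimplex_def scale_def sum_distrib_left)
  finally show "osimplex (permute_list q vs) ws = (of_int (sign q) \<odot> osimplex vs) ws" .
qed

text \<open>A transposition of neighbours has sign -1. This form of antisymmetry suits recursion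
  over lists.\<close>

lemma osimplex_swap: "osimplex (xs @ b # a # ys) = - osimplex (xs @ a # b # ys)"
proof -
  define q where "q = Transposition.transpose (length xs) (Suc (length xs))"
  have q: "q permutes {..<length (xs @ a # b # ys)}"
    unfolding q_def by (rule permutes_swap_id) auto
  have "permute_list q (xs @ a # b # ys) = xs @ b # a # ys"
  proof (rule nth_equalityI)
    fix i
    assume "i < length (permute_list q (xs @ a # b # ys))"
    then have "permute_list q (xs @ a # b # ys) ! i = (xs @ a # b # ys) ! q i"
      using q by (simp add: permute_list_nth)
    also have "\<dots> = (xs @ b # a # ys) ! i"
      by (auto simp: q_def transpose_def nth_append nth_Cons split: nat.split)
    finally show "permute_list q (xs @ a # b # ys) ! i = (xs @ b # a # ys) ! i" .
  qed simp
  moreover have "sign q = - 1"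
    by (simp add: q_def sign_swap_id)
  ultimately show ?thesis
    using osimplex_permute_list[OF q] by simp
qed

lemma osimplex_swap_Cons:
  "osimplex (c # xs @ b # a # ys) = - osimplex (c # xs @ a # b # ys)"
  "osimplex (d # c # xs @ b # a # ys) = - osimplex (d # c # xs @ a # b # ys)"
  using osimplex_swap[of "c # xs" b a ys] osimplex_swap[of "d # c # xs" b a ys] by simp_all

lemma osimplex_swap_first:
  "osimplex (b # a # ys) = - osimplex (a # b # ys)"
  "osimplex (c # b # a # ys) = - osimplex (c # a # b # ys)"
  using osimplex_swap[of "[]" b a ys] osimplex_swap[of "[c]" b a ys] by simp_all

text \<open>Sorting by adjacent exchanges: the head of \<open>vs\<close> is located in
  \<open>us\<close>, moved to the front, and the tails are treated recursively.\<close>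

lemma adjacent_swap_induct:
  assumes "mset vs = mset us" "Q us" "\<And>xs a b ys. Q (xs @ a # b # ys) \<Longrightarrow> Q (xs @ b # a # ys)"
  shows "Q vs"
  using assms
proof (induction vs arbitrary: us Q)
  case (Cons v vs)
  then obtain us1 us2 where us: "us = us1 @ v # us2"
    by (metis list.set_intros(1) set_mset_mset split_list)
  \<comment> \<open>\<open>v\<close> walks left and passes the last entry of \<open>us1\<close>
    first, hence the induction from the right end.\<close>
  have "Q (us1 @ v # zs) \<Longrightarrow> Q (v # us1 @ zs)" for zs
  proof (induction us1 arbitrary: zs rule: rev_induct)
    case (snoc x us1)
    from snoc.IH[of "x # zs"] snoc.prems Cons.prems(3)[of us1 x v zs] show ?case
      by simp
  qed simp
  with Cons.prems(2) have "Q (v # us1 @ us2)"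
    by (simp add: us)
  moreover have "mset vs = mset (us1 @ us2)"
    using Cons.prems(1) by (simp add: us)
  \<comment> \<open>The predicate that keeps \<open>v\<close> in front is again closed under
    exchanges, so it may replace \<open>Q\<close> in the induction hypothesis.\<close>
  moreover have "Q (v # xs @ b # a # ys)" if "Q (v # xs @ a # b # ys)" for xs a b ys
    using Cons.prems(3)[of "v # xs" a b ys] that by simp
  ultimately show ?case
    using Cons.IH[of "us1 @ us2" "\<lambda>ws. Q (v # ws)"] by simp
qed simp

text \<open>The fixed prefix \<open>us\<close> serves maps whose defining formula is only antisymmetric in the
  vertices after \<open>e\<^sub>\<star>\<close>.\<close>

lemma linear_extension_osimplex_unsorted:
  assumes sorted: "sorted_wrt (<) (us @ sort vs)"
    and swap: "\<And>xs a b ys. f (us @ xs @ b # a # ys) = - f (us @ xs @ a # b # ys)"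
  shows "linear_extension f (osimplex (us @ vs)) = f (us @ vs)"
proof (rule adjacent_swap_induct[of vs "sort vs"])
  show "linear_extension f (osimplex (us @ sort vs)) = f (us @ sort vs)"
    by (rule linear_extension_osimplex[OF sorted])
next
  fix xs a b ys
  assume "linear_extension f (osimplex (us @ xs @ a # b # ys)) = f (us @ xs @ a # b # ys)"
  then show "linear_extension f (osimplex (us @ xs @ b # a # ys)) = f (us @ xs @ b # a # ys)"
    using osimplex_swap[of "us @ xs" b a ys] swap[of xs b a ys] by (simp add: linear_extension_uminus)
qed simp

section \<open>The chain groups: closure properties, basis expansion and induction\<close>

lemma ochains_fin_supp: "c \<in> ochains l K \<Longrightarrow> fin_supp c"
  by (simp add: ochains_def fin_supp_def)

lemma ochains_0: "0 \<in> ochains l K"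
  by (simp add: ochains_def alternating_def)

lemma ochains_add:
  assumes c: "c \<in> ochains l K" and d: "d \<in> ochains l K"
  shows "c + d \<in> ochains l K"
  unfolding ochains_def
proof (intro CollectI conjI allI impI)
  show "alternating (c + d)"
    using c d by (simp add: ochains_def alternating_def distrib_left)
  show "finite {vs. (c + d) vs \<noteq> 0}"
    using fin_supp_add[OF c[THEN ochains_fin_supp] d[THEN ochains_fin_supp]] by (simp only: fin_supp_def)
  fix vs
  assume "(c + d) vs \<noteq> 0"
  then have "c vs \<noteq> 0 \<or> d vs \<noteq> 0"
    by auto
  then show "length vs = l + 1" "distinct vs" "set vs \<in> K"
    using c d unfolding ochains_def by blast+
qed

lemma ochains_scale: "c \<in> ochains l K \<Longrightarrow> r \<odot> c \<in> ochains l K"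
  using fin_supp_scale[of c r] by (simp add: ochains_def fin_supp_def alternating_def scale_def)

lemma ochains_diff: "c \<in> ochains l K \<Longrightarrow> d \<in> ochains l K \<Longrightarrow> c - d \<in> ochains l K"
  using ochains_add[of c l K "(-1) \<odot> d"] ochains_scale[of d l K "-1"]
  by simp

lemma ochains_sum: "(\<And>x. x \<in> A \<Longrightarrow> f x \<in> ochains l K) \<Longrightarrow> (\<Sum>x\<in>A. f x) \<in> ochains l K"
  by (induction A rule: infinite_finite_induct) (auto simp: ochains_0 ochains_add)

lemma osimplex_in_ochains:
  assumes "distinct vs" "length vs = l + 1" "set vs \<in> K"
  shows "osimplex vs \<in> ochains l K"
proof -
  have "length ws = l + 1 \<and> distinct ws \<and> set ws \<in> K" if nz: "osimplex vs ws \<noteq> 0" for ws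
  proof -
    obtain p where "p permutes {..<length vs}" "permute_list p vs = ws"
      using osimplex_nonzeroD[OF nz] by blast
    then show ?thesis
      using assms by auto
  qed
  then show ?thesis
    using fin_supp_osimplex[of vs]
    by (simp add: ochains_def alternating_def osimplex_permute fin_supp_def)
qed

text \<open>Chains vanish on lists with repetitions, and alternation determines the value at a
  distinct list from the value at its sorted rearrangement.\<close>

lemma ochains_eqI:
  fixes c :: "'v::linorder chain"
  assumes c: "c \<in> ochains l K" and d: "d \<in> ochains l K"
    and eq: "\<And>vs. sorted_wrt (<) vs \<Longrightarrow> c vs = d vs"
  shows "c = d"
proof
  fix ws
  show "c ws = d ws"
  proof (cases "distinct ws")
    case True
    obtain p where p: "p permutes {..<length (sort ws)}" "permute_list p (sort ws) = ws"
      using mset_eq_permutation[of ws "sort ws"] by auto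
    have sort: "e ws = of_int (sign p) * e (sort ws)" if "e \<in> ochains l K" for e
    proof -
      have "e (permute_list p (sort ws)) = of_int (sign p) * e (sort ws)"
        using that p(1) by (simp only: ochains_def alternating_def mem_Collect_eq)
      then show ?thesis
        by (simp only: p(2))
    qed
    have "c (sort ws) = d (sort ws)"
      using True by (intro eq) (simp add: strict_sorted_iff)
    then show ?thesis
      by (simp only: sort[OF c] sort[OF d])
  next
    case False
    with c d have "c ws = 0" "d ws = 0"
      unfolding ochains_def by blast+
    then show ?thesis
      by simp
  qed
qed

lemma ochains_expand:
  fixes c :: "'v::linorder chain"
  assumes c: "c \<in> ochains l K"
  shows "c = (\<Sum>vs | c vs \<noteq> 0 \<and> sorted_wrt (<) vs. c vs \<odot> osimplex vs)"
proof (rule ochains_eqI[OF c])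
  let ?S = "{vs. c vs \<noteq> 0 \<and> sorted_wrt (<) vs}"
  have fin: "finite ?S"
    using c by (simp add: ochains_def)
  show "(\<Sum>vs\<in>?S. c vs \<odot> osimplex vs) \<in> ochains l K"
    using c by (intro ochains_sum ochains_scale osimplex_in_ochains) (auto simp: ochains_def)
  fix ws :: "'v list"
  assume ws: "sorted_wrt (<) ws"
  \<comment> \<open>Increasing lists that are permutations of each other are equal, so on increasing
    lists an increasing simplex is an indicator function.\<close>
  have "osimplex vs ws = (if vs = ws then 1 else 0)" if "vs \<in> ?S" for vs
  proof (cases "osimplex vs ws = 0")
    case True
    with ws osimplex_self[of vs] show ?thesis
      by (auto simp: strict_sorted_iff)
  next
    case False
    then have "set ws = set vs"
      using osimplex_nonzeroD by fastforce
    with ws that have "vs = ws"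
      by (auto intro: strict_sorted_equal)
    with ws osimplex_self[of vs] show ?thesis
      by (auto simp: strict_sorted_iff)
  qed
  then have "(\<Sum>vs\<in>?S. c vs \<odot> osimplex vs) ws = (\<Sum>vs\<in>?S. if vs = ws then c vs else 0)"
    unfolding sum_chain_apply scale_def by (intro sum.cong) auto
  then show "c ws = (\<Sum>vs\<in>?S. c vs \<odot> osimplex vs) ws"
    using fin ws by (simp add: sum.delta)
qed

lemma ochains_induct [consumes 1, case_names zero add scale osimplex]:
  fixes c :: "'v::linorder chain"
  assumes c: "c \<in> ochains l K"
    and zero: "P 0"
    and add: "\<And>c d. c \<in> ochains l K \<Longrightarrow> d \<in> ochains l K \<Longrightarrow> P c \<Longrightarrow> P d \<Longrightarrow> P (c + d)"
    and scale: "\<And>r c. c \<in> ochains l K \<Longrightarrow> P c \<Longrightarrow> P (r \<odot> c)"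
    and osimplex: "\<And>vs. sorted_wrt (<) vs \<Longrightarrow> length vs = l + 1 \<Longrightarrow> set vs \<in> K \<Longrightarrow> P (osimplex vs)"
  shows "P c"
proof -
  \<comment> \<open>Membership of the partial sums is carried along because \<open>add\<close> asks
    for it.\<close>
  have "P (\<Sum>vs\<in>S. c vs \<odot> osimplex vs) \<and> (\<Sum>vs\<in>S. c vs \<odot> osimplex vs) \<in> ochains l K"
    if "finite S" "S \<subseteq> {vs. c vs \<noteq> 0 \<and> sorted_wrt (<) vs}" for S
    using that
  proof (induction S)
    case (insert vs S)
    then have vs: "sorted_wrt (<) vs" "length vs = l + 1" "set vs \<in> K"
      using c by (auto simp: ochains_def)
    then have "osimplex vs \<in> ochains l K"
      by (intro osimplex_in_ochains) (auto simp: strict_sorted_iff)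
    moreover from this have "P (c vs \<odot> osimplex vs)"
      by (intro scale osimplex vs)
    moreover have "c vs \<odot> osimplex vs \<in> ochains l K"
      using calculation by (simp add: ochains_scale)
    moreover have "P (\<Sum>vs\<in>S. c vs \<odot> osimplex vs)" "(\<Sum>vs\<in>S. c vs \<odot> osimplex vs) \<in> ochains l K"
      using insert by auto
    ultimately show ?case
      unfolding sum.insert[OF insert(1,2)] by (intro conjI ochains_add add)
  qed (simp add: zero ochains_0)
  moreover have "finite {vs. c vs \<noteq> 0 \<and> sorted_wrt (<) vs}"
    using c by (simp add: ochains_def)
  ultimately show ?thesis
    using ochains_expand[OF c] by (metis (no_types, lifting) order_refl)
qed


section \<open>Alternating sums over faces\<close>

text \<open>The alternating sum of \<open>h v\<^sub>i [v\<^sub>0, \<dots>, v\<^sub>i\<^sub>-\<^sub>1, v\<^sub>i\<^sub>+\<^sub>1, \<dots>]\<close>, in recursive form so that no indices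
  or signs occur in the calculations.\<close>

fun face_sum :: "('v \<Rightarrow> 'v list \<Rightarrow> 'c::ab_group_add) \<Rightarrow> 'v list \<Rightarrow> 'c" where
  "face_sum h [] = 0"
| "face_sum h (v # vs) = h v vs - face_sum (\<lambda>u ws. h u (v # ws)) vs"

text \<open>Passing to the tail shifts every index by one, which is the minus sign in the
  recursion.\<close>

lemma sum_omit_eq_face_sum: "(\<Sum>i<length vs. (-1) ^ i \<odot> h (vs ! i) (omit i vs)) = face_sum h vs"
proof (induction vs arbitrary: h)
  case (Cons v vs)
  have "(\<Sum>i<length vs. (-1) ^ Suc i \<odot> h (vs ! i) (v # omit i vs))
      = - (\<Sum>i<length vs. (-1) ^ i \<odot> h (vs ! i) (v # omit i vs))"
    by (simp add: chain.scale_minus_left sum_negf)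
  with Cons[of "\<lambda>u ws. h u (v # ws)"] show ?case
    by (simp add: sum.lessThan_Suc_shift omit_def del: sum.lessThan_Suc)
qed simp

text \<open>Without repetitions the face opposite \<open>v\<close> is \<open>remove1 v vs\<close>,
  so terms can be compared vertex by vertex without positions.\<close>

lemma face_sum_cong:
  assumes "distinct vs" "\<And>v. v \<in> set vs \<Longrightarrow> h v (remove1 v vs) = h' v (remove1 v vs)"
  shows "face_sum h vs = face_sum h' vs"
  using assms
proof (induction vs arbitrary: h h')
  case (Cons v vs)
  have "face_sum (\<lambda>u ws. h u (v # ws)) vs = face_sum (\<lambda>u ws. h' u (v # ws)) vs"
  proof (rule Cons.IH)
    fix u
    assume "u \<in> set vs"
    with Cons.prems(1) Cons.prems(2)[of u] show "h u (v # remove1 u vs) = h' u (v # remove1 u vs)"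
      by (auto split: if_splits)
  qed (use Cons.prems in simp)
  with Cons.prems(2)[of v] show ?case
    by simp
qed simp

lemma face_sum_0: "face_sum (\<lambda>v ws. 0) vs = 0"
  by (induction vs) auto

lemma face_sum_add: "face_sum (\<lambda>v ws. h v ws + h' v ws) vs = face_sum h vs + face_sum h' vs"
proof (induction vs arbitrary: h h')
  case (Cons v vs)
  note IH = Cons[of "\<lambda>u ws. h u (v # ws)" "\<lambda>u ws. h' u (v # ws)"]
  show ?case
    by (simp only: face_sum.simps IH) (simp only: algebra_simps)
qed (simp only: face_sum.simps, simp)

lemma face_sum_uminus: "face_sum (\<lambda>v ws. - h v ws) vs = - face_sum h vs"
  using face_sum_add[of h "\<lambda>v ws. - h v ws" vs]
  by (simp add: face_sum_0 eq_neg_iff_add_eq_0 add.commute)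

lemma face_sum_sum: "face_sum (\<lambda>v ws. \<Sum>x\<in>A. h x v ws) vs = (\<Sum>x\<in>A. face_sum (h x) vs)"
proof (induction A rule: infinite_finite_induct)
  case (insert x A)
  then show ?case
    by (simp only: sum.insert[OF insert(1,2)] face_sum_add insert(3))
qed (simp_all add: face_sum_0)

lemma face_sum_scale: "face_sum (\<lambda>v ws. r \<odot> h v ws) vs = r \<odot> face_sum h vs"
proof (induction vs arbitrary: h)
  case (Cons v vs)
  note IH = Cons[of "\<lambda>u ws. h u (v # ws)"]
  show ?case
    by (simp only: face_sum.simps IH chain.scale_right_diff_distrib)
qed (simp only: face_sum.simps chain.scale_zero_right)

lemma fin_supp_face_sum [simp]: "(\<And>v ws. fin_supp (h v ws)) \<Longrightarrow> fin_supp (face_sum h vs)"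
  by (induction vs arbitrary: h) auto

lemma linear_extension_face_sum:
  assumes "\<And>v ws. fin_supp (h v ws)"
  shows "linear_extension f (face_sum h vs) = face_sum (\<lambda>v ws. linear_extension f (h v ws)) vs"
  using assms
proof (induction vs arbitrary: h)
  case (Cons v vs)
  note IH = Cons.IH[of "\<lambda>u ws. h u (v # ws)", OF Cons.prems]
  have "fin_supp (face_sum (\<lambda>u ws. h u (v # ws)) vs)"
    by (rule fin_supp_face_sum) (rule Cons.prems)
  with Cons.prems show ?case
    by (simp only: face_sum.simps IH linear_extension_diff)
qed (simp only: face_sum.simps linear_extension_0)

lemma face_sum_in_ochains:
  assumes "distinct vs" "\<And>v. v \<in> set vs \<Longrightarrow> h v (remove1 v vs) \<in> ochains l K"
  shows "face_sum h vs \<in> ochains l K"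
  using assms
proof (induction vs arbitrary: h)
  case (Cons v vs)
  have "face_sum (\<lambda>u ws. h u (v # ws)) vs \<in> ochains l K"
  proof (rule Cons.IH)
    fix u
    assume "u \<in> set vs"
    with Cons.prems(1) Cons.prems(2)[of u] show "h u (v # remove1 u vs) \<in> ochains l K"
      by (auto split: if_splits)
  qed (use Cons.prems in simp)
  with Cons.prems(2)[of v] show ?case
    unfolding face_sum.simps by (intro ochains_diff) auto
qed (simp add: ochains_0)

text \<open>Faces that keep both \<open>a\<close> and \<open>b\<close> change sign by hypothesis.
  The faces omitting \<open>a\<close> or \<open>b\<close> are the same on both sides, but their
  positions, and hence their signs, are interchanged.\<close>

lemma face_sum_swap:
  fixes h :: "'v \<Rightarrow> 'v list \<Rightarrow> 'c::ab_group_add"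
  assumes "\<And>v xs a b ys. h v (xs @ b # a # ys) = - h v (xs @ a # b # ys)"
  shows "face_sum h (xs @ b # a # ys) = - face_sum h (xs @ a # b # ys)"
  using assms
proof (induction xs arbitrary: h)
  case Nil
  have "h u (b # a # ws) = - h u (a # b # ws)" for u ws
    using Nil[of u "[]" b a ws] by simp
  then show ?case
    by (simp add: face_sum_uminus)
next
  case (Cons x xs)
  have "face_sum (\<lambda>u ws. h u (x # ws)) (xs @ b # a # ys) = - face_sum (\<lambda>u ws. h u (x # ws)) (xs @ a # b # ys)"
  proof (rule Cons.IH)
    fix v ys zs and a b :: 'v
    show "h v (x # ys @ b # a # zs) = - h v (x # ys @ a # b # zs)"
      using Cons.prems[of v "x # ys" b a zs] by simp
  qed
  with Cons.prems[of x xs b a ys] show ?case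
    by simp
qed

text \<open>Moving the reinserted vertex from the front to its old position i costs (-1)^i, which
  cancels the sign of the face; so each vertex satisfying \<open>P\<close> yields one copy of
  \<open>h vs\<close>.\<close>

lemma face_sum_insert:
  fixes h :: "'v list \<Rightarrow> 'w chain"
  assumes "distinct vs" "\<And>xs a b ys. h (xs @ b # a # ys) = - h (xs @ a # b # ys)"
  shows "face_sum (\<lambda>v ws. if P v then h (v # ws) else 0) vs = real (card {v \<in> set vs. P v}) \<odot> h vs"
  using assms
proof (induction vs arbitrary: h)
  case (Cons v vs)
  have IH: "face_sum (\<lambda>u ws. if P u then h (v # u # ws) else 0) vs = real (card {v \<in> set vs. P v}) \<odot> h (v # vs)"
  proof (rule Cons.IH)
    show "h (v # xs @ b # a # ys) = - h (v # xs @ a # b # ys)" for xs a b ys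
      using Cons.prems(2)[of "v # xs" b a ys] by (simp only: append_Cons)
  qed (use Cons.prems(1) in simp)
  \<comment> \<open>The induction hypothesis has \<open>v\<close> in front, so the reinserted
    \<open>u\<close> is moved past it; this exchange cancels the minus sign of the
    recursion.\<close>
  have "(if P u then h (u # v # ws) else 0) = - (if P u then h (v # u # ws) else 0)" for u ws
    using Cons.prems(2)[of "[]" u v ws]
    by (cases "P u") (simp_all only: append_Nil if_True if_False minus_zero)
  then have "face_sum (\<lambda>u ws. if P u then h (u # v # ws) else 0) vs
      = face_sum (\<lambda>u ws. - (if P u then h (v # u # ws) else 0)) vs"
    by (simp only:)
  also have "\<dots> = - (real (card {v \<in> set vs. P v}) \<odot> h (v # vs))"
    by (simp only: face_sum_uminus IH)
  finally have step: "face_sum (\<lambda>u ws. if P u then h (u # v # ws) else 0) vs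
      = - (real (card {v \<in> set vs. P v}) \<odot> h (v # vs))" .
  have "{w \<in> set (v # vs). P w} = (if P v then insert v {w \<in> set vs. P w} else {w \<in> set vs. P w})"
    by auto
  then have "card {w \<in> set (v # vs). P w} = (if P v then 1 else 0) + card {w \<in> set vs. P w}"
    using Cons.prems(1) by simp
  then show ?case
    unfolding face_sum.simps step by (auto simp: fun_eq_iff scale_def algebra_simps)
qed (simp add: scale_def fun_eq_iff)


section \<open>The maps on oriented simplices\<close>

text \<open>The definition fixes values on increasing lists only; the formula is needed for lists
  such as \<open>e\<^sub>\<star> # E \<alpha> # vs\<close>, with a vertex inserted out of order. It
  extends to them because face sums are antisymmetric.\<close>

lemma boundary_osimplex:
  fixes vs :: "'v::linorder list"
  assumes "distinct vs"
  shows "\<partial> (osimplex vs) = (if length vs \<le> 1 then 0 else face_sum (\<lambda>_. osimplex) vs)"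
proof -
  let ?f = "\<lambda>vs :: 'v list. if length vs \<le> 1 then 0 else face_sum (\<lambda>_. osimplex) vs"
  have "linear_extension ?f (osimplex ([] @ vs)) = ?f ([] @ vs)"
  proof (rule linear_extension_osimplex_unsorted)
    fix xs a b and ys :: "'v list"
    have "face_sum (\<lambda>_. osimplex) (xs @ b # a # ys) = - face_sum (\<lambda>_. osimplex) (xs @ a # b # ys)"
      by (rule face_sum_swap) (rule osimplex_swap)
    then show "?f ([] @ xs @ b # a # ys) = - ?f ([] @ xs @ a # b # ys)"
      by simp
  qed (use assms in \<open>simp add: strict_sorted_iff\<close>)
  moreover have "\<partial> = linear_extension ?f"
    by (simp only: boundary_def sum_omit_eq_face_sum[of "\<lambda>_. osimplex"])
  ultimately show ?thesis
    by (simp only: append_Nil)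
qed

text \<open>The restricted sum is a full face sum with zero terms for vertices outside I. Exchanging
  neighbours does not affect whether I is contained, so the same branch applies after
  reordering.\<close>

lemma weld_incl_osimplex:
  assumes "distinct vs"
  shows "i\<^sub>\<star> I (osimplex vs) =
    (if E ` I \<subseteq> set vs
     then face_sum (\<lambda>v ws. if v \<in> E ` I then osimplex (e\<^sub>\<star> # ws) else 0) vs
     else osimplex vs)"
proof -
  let ?h = "\<lambda>v ws. if v \<in> E ` I then osimplex (e\<^sub>\<star> # ws) else 0"
  let ?f = "\<lambda>vs. if E ` I \<subseteq> set vs then face_sum ?h vs else osimplex vs"
  have "(\<Sum>i | i < length vs \<and> vs ! i \<in> E ` I. (-1) ^ i \<odot> osimplex (e\<^sub>\<star> # omit i vs)) = face_sum ?h vs" for vs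
  proof -
    have "(\<Sum>i | i < length vs \<and> vs ! i \<in> E ` I. (-1) ^ i \<odot> osimplex (e\<^sub>\<star> # omit i vs))
        = (\<Sum>i<length vs. if vs ! i \<in> E ` I then (-1) ^ i \<odot> osimplex (e\<^sub>\<star> # omit i vs) else 0)"
      using sum.inter_filter[of "{..<length vs}" "\<lambda>i. (-1) ^ i \<odot> osimplex (e\<^sub>\<star> # omit i vs)" "\<lambda>i. vs ! i \<in> E ` I"]
      by simp
    also have "\<dots> = (\<Sum>i<length vs. (-1) ^ i \<odot> ?h (vs ! i) (omit i vs))"
      by (intro sum.cong) (auto simp: chain.scale_zero_right)
    also have "\<dots> = face_sum ?h vs"
      by (rule sum_omit_eq_face_sum)
    finally show ?thesis .
  qed
  then have "i\<^sub>\<star> I = linear_extension ?f"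
    by (simp only: weld_incl_def)
  moreover have "linear_extension ?f (osimplex ([] @ vs)) = ?f ([] @ vs)"
  proof (rule linear_extension_osimplex_unsorted)
    fix xs a b ys
    have "face_sum ?h (xs @ b # a # ys) = - face_sum ?h (xs @ a # b # ys)"
    proof (rule face_sum_swap)
      show "?h v (xs @ b # a # ys) = - ?h v (xs @ a # b # ys)" for v xs a b ys
        using osimplex_swap_Cons(1)[of "e\<^sub>\<star>" xs b a ys] by simp
    qed
    moreover have "set (xs @ b # a # ys) = set (xs @ a # b # ys)"
      by auto
    moreover note osimplex_swap[of xs b a ys]
    ultimately show "?f ([] @ xs @ b # a # ys) = - ?f ([] @ xs @ a # b # ys)"
      by (simp only: append_Nil split: if_split) simp
  qed (use assms in \<open>simp add: strict_sorted_iff\<close>)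
  ultimately show ?thesis
    by (simp only: append_Nil)
qed

abbreviation missing :: "nat set \<Rightarrow> vertex list \<Rightarrow> nat set" where
  "missing I vs \<equiv> {\<alpha> \<in> I. E \<alpha> \<notin> set vs}"

lemma Star_less: "v \<noteq> e\<^sub>\<star> \<Longrightarrow> e\<^sub>\<star> < v"
  by (cases v) (auto simp: less_vertex_def)

text \<open>The star vertex is least, so it stays first when the rest is sorted; it is the fixed
  prefix in the next two formulas.\<close>

lemma sorted_Star_Cons_sort: "distinct vs \<Longrightarrow> e\<^sub>\<star> \<notin> set vs \<Longrightarrow> sorted_wrt (<) ([e\<^sub>\<star>] @ sort vs)"
  by (auto simp: strict_sorted_iff intro: Star_less)

text \<open>The range of summation depends only on the set of vertices, and each summand is
  antisymmetric in \<open>vs\<close>, so the order of \<open>vs\<close> does not matter.\<close>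

lemma weld_proj_osimplex_Star:
  assumes "distinct vs" "e\<^sub>\<star> \<notin> set vs"
  shows "p\<^sub>\<star> I (osimplex (e\<^sub>\<star> # vs)) =
    (1 / real (card I)) \<odot> (\<Sum>\<alpha>\<in>missing I vs. osimplex (E \<alpha> # vs))"
proof -
  have "linear_extension (weld_proj_basis I) (osimplex ([e\<^sub>\<star>] @ vs)) = weld_proj_basis I ([e\<^sub>\<star>] @ vs)"
  proof (rule linear_extension_osimplex_unsorted)
    fix xs a b ys
    have "osimplex (E \<alpha> # xs @ b # a # ys) = - osimplex (E \<alpha> # xs @ a # b # ys)" for \<alpha>
      by (rule osimplex_swap_Cons)
    moreover have "missing I (xs @ b # a # ys) = missing I (xs @ a # b # ys)"
      by auto
    ultimately show "weld_proj_basis I ([e\<^sub>\<star>] @ xs @ b # a # ys) = - weld_proj_basis I ([e\<^sub>\<star>] @ xs @ a # b # ys)"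
      by (simp only: append_Cons append_Nil weld_proj_basis.simps sum_negf chain.scale_minus_right)
  qed (rule sorted_Star_Cons_sort[OF assms])
  then show ?thesis
    by (simp add: weld_proj_def)
qed

lemma weld_htpy_osimplex_Star:
  assumes "distinct vs" "e\<^sub>\<star> \<notin> set vs"
  shows "a\<^sub>\<star> I (osimplex (e\<^sub>\<star> # vs)) =
    (if card (missing I vs) = 1 then 0
     else (- 1 / real (card I)) \<odot> (\<Sum>\<alpha>\<in>missing I vs. osimplex (e\<^sub>\<star> # E \<alpha> # vs)))"
proof -
  have "linear_extension (weld_htpy_basis I) (osimplex ([e\<^sub>\<star>] @ vs)) = weld_htpy_basis I ([e\<^sub>\<star>] @ vs)"
  proof (rule linear_extension_osimplex_unsorted)
    fix xs a b ys
    have "osimplex (e\<^sub>\<star> # E \<alpha> # xs @ b # a # ys) = - osimplex (e\<^sub>\<star> # E \<alpha> # xs @ a # b # ys)" for \<alpha>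
      by (rule osimplex_swap_Cons)
    moreover have "missing I (xs @ b # a # ys) = missing I (xs @ a # b # ys)"
      by auto
    ultimately show "weld_htpy_basis I ([e\<^sub>\<star>] @ xs @ b # a # ys) = - weld_htpy_basis I ([e\<^sub>\<star>] @ xs @ a # b # ys)"
      by (simp only: append_Cons append_Nil weld_htpy_basis.simps sum_negf chain.scale_minus_right
          split: if_split) simp
  qed (rule sorted_Star_Cons_sort[OF assms])
  then show ?thesis
    by (simp add: weld_htpy_def)
qed

lemma weld_proj_htpy_osimplex_without_Star:
  assumes "sorted_wrt (<) vs" "e\<^sub>\<star> \<notin> set vs"
  shows "p\<^sub>\<star> I (osimplex vs) = osimplex vs" "a\<^sub>\<star> I (osimplex vs) = 0"
  using linear_extension_osimplex[OF assms(1), of "weld_proj_basis I"]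
    linear_extension_osimplex[OF assms(1), of "weld_htpy_basis I"] assms
  by (cases "(I, vs)" rule: weld_proj_basis.cases; simp add: weld_proj_def weld_htpy_def)+

section \<open>Linearity of the four maps on finitely supported functions\<close>

lemma fin_supp_boundary [simp]: "fin_supp (\<partial> c)"
  unfolding boundary_def by (rule fin_supp_linear_extension) simp

lemma fin_supp_weld_incl [simp]: "fin_supp (i\<^sub>\<star> I c)"
  unfolding weld_incl_def by (rule fin_supp_linear_extension) simp

lemma fin_supp_weld_proj [simp]: "fin_supp (p\<^sub>\<star> I c)"
  unfolding weld_proj_def
proof (rule fin_supp_linear_extension)
  show "fin_supp (weld_proj_basis I vs)" for vs
    by (cases "(I, vs)" rule: weld_proj_basis.cases) auto
qed

lemma fin_supp_weld_htpy [simp]: "fin_supp (a\<^sub>\<star> I c)"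
  unfolding weld_htpy_def
proof (rule fin_supp_linear_extension)
  show "fin_supp (weld_htpy_basis I vs)" for vs
    by (cases "(I, vs)" rule: weld_htpy_basis.cases) auto
qed

lemma chain_maps_add:
  assumes "fin_supp c" "fin_supp d"
  shows "a\<^sub>\<star> I (c + d) = a\<^sub>\<star> I c + a\<^sub>\<star> I d" "p\<^sub>\<star> I (c + d) = p\<^sub>\<star> I c + p\<^sub>\<star> I d"
    "i\<^sub>\<star> I (c + d) = i\<^sub>\<star> I c + i\<^sub>\<star> I d" "\<partial> (c + d) = \<partial> c + \<partial> d"
  by (simp_all only: weld_htpy_def weld_proj_def weld_incl_def boundary_def linear_extension_add assms)

lemma weld_htpy_diff:
  assumes "fin_supp c" "fin_supp d"
  shows "a\<^sub>\<star> I (c - d) = a\<^sub>\<star> I c - a\<^sub>\<star> I d"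
  by (simp only: weld_htpy_def linear_extension_diff assms)

lemma chain_maps_scale:
  assumes "fin_supp c"
  shows "a\<^sub>\<star> I (r \<odot> c) = r \<odot> a\<^sub>\<star> I c" "p\<^sub>\<star> I (r \<odot> c) = r \<odot> p\<^sub>\<star> I c"
    "i\<^sub>\<star> I (r \<odot> c) = r \<odot> i\<^sub>\<star> I c" "\<partial> (r \<odot> c) = r \<odot> \<partial> c"
  by (simp_all only: weld_htpy_def weld_proj_def weld_incl_def boundary_def linear_extension_scale assms)

lemma chain_maps_sum:
  assumes "\<And>x. x \<in> A \<Longrightarrow> fin_supp (g x)"
  shows "a\<^sub>\<star> I (\<Sum>x\<in>A. g x) = (\<Sum>x\<in>A. a\<^sub>\<star> I (g x))" "p\<^sub>\<star> I (\<Sum>x\<in>A. g x) = (\<Sum>x\<in>A. p\<^sub>\<star> I (g x))"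
    "i\<^sub>\<star> I (\<Sum>x\<in>A. g x) = (\<Sum>x\<in>A. i\<^sub>\<star> I (g x))" "\<partial> (\<Sum>x\<in>A. g x) = (\<Sum>x\<in>A. \<partial> (g x))"
  by (simp_all only: weld_htpy_def weld_proj_def weld_incl_def boundary_def linear_extension_sum assms)

lemma weld_htpy_face_sum:
  assumes "\<And>v ws. fin_supp (h v ws)"
  shows "a\<^sub>\<star> I (face_sum h vs) = face_sum (\<lambda>v ws. a\<^sub>\<star> I (h v ws)) vs"
  unfolding weld_htpy_def using assms by (rule linear_extension_face_sum)

lemma chain_maps_0 [simp]: "a\<^sub>\<star> I 0 = 0" "p\<^sub>\<star> I 0 = 0" "i\<^sub>\<star> I 0 = 0" "\<partial> 0 = 0"
  by (simp_all add: weld_htpy_def weld_proj_def weld_incl_def boundary_def)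


section \<open>The identities on oriented simplices\<close>

text \<open>Omitting \<open>v\<close> from J returns it to I - J exactly if it lies in I; the extra
  summand is the one that will put \<open>v\<close> back.\<close>

lemma sum_missing_remove1:
  assumes "finite I" "distinct vs" "v \<in> set vs"
  shows "(\<Sum>\<alpha>\<in>missing I (remove1 v vs). g (E \<alpha>))
    = (\<Sum>\<alpha>\<in>missing I vs. g (E \<alpha>)) + (if v \<in> E ` I then g v else 0)"
proof (cases "v \<in> E ` I")
  case True
  then obtain \<beta> where \<beta>: "v = E \<beta>" "\<beta> \<in> I"
    by auto
  then have "missing I (remove1 v vs) = insert \<beta> (missing I vs)" "\<beta> \<notin> missing I vs"
    using assms by auto
  with assms \<beta> show ?thesis
    by (simp add: add.commute)
next
  case False
  then have "missing I (remove1 v vs) = missing I vs"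
    using assms by auto
  with False show ?thesis
    by simp
qed

lemma card_missing_remove1:
  assumes "finite I" "distinct vs" "v \<in> set vs"
  shows "card (missing I (remove1 v vs)) = card (missing I vs) + (if v \<in> E ` I then 1 else 0)"
  using sum_missing_remove1[OF assms, of "\<lambda>_. 1 :: nat"] by simp

text \<open>I splits into I - J and I \<inter> J. Hence the copies of [star, J] coming from the two
  parts add up to |I| and cancel the denominator.\<close>

lemma card_missing_add_card_present:
  assumes "finite I"
  shows "card (missing I vs) + card {v \<in> set vs. v \<in> E ` I} = card I"
proof -
  have "{v \<in> set vs. v \<in> E ` I} = E ` (I - missing I vs)"
    by auto
  then have "card {v \<in> set vs. v \<in> E ` I} = card (I - missing I vs)"
    by (simp add: card_image inj_on_def)
  also have "\<dots> = card I - card (missing I vs)"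
    using assms by (intro card_Diff_subset) auto
  finally show ?thesis
    using card_mono[OF assms, of "missing I vs"] by auto
qed

text \<open>Whether \<open>i\<^sub>\<star>\<close> subdivides [\<alpha>, J] and whether the
  exceptional clause of \<open>a\<^sub>\<star>\<close> applies to [star, J] are thus the same
  question.\<close>

lemma missing_singleton_iff:
  "\<alpha> \<in> missing I vs \<Longrightarrow> finite I \<Longrightarrow> E ` I \<subseteq> set (E \<alpha> # vs) \<longleftrightarrow> card (missing I vs) = 1"
proof
  assume "\<alpha> \<in> missing I vs" "E ` I \<subseteq> set (E \<alpha> # vs)"
  then have "missing I vs = {\<alpha>}"
    by auto
  then show "card (missing I vs) = 1"
    by simp
next
  assume \<alpha>: "\<alpha> \<in> missing I vs" and "card (missing I vs) = 1"
  then have "missing I vs = {\<alpha>}"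
    by (metis card_1_singletonE singletonD)
  then show "E ` I \<subseteq> set (E \<alpha> # vs)"
    by auto
qed

text \<open>The terms for (a, b) and (b, a) cancel; at each list the real value S of the sum
  satisfies S = -S.\<close>

lemma sum_antisym_eq_0:
  fixes g :: "'a \<Rightarrow> 'a \<Rightarrow> 'v chain"
  assumes "finite A" "\<And>a b. g b a = - g a b"
  shows "(\<Sum>a\<in>A. \<Sum>b\<in>A - {a}. g a b) = 0"
proof
  fix x
  \<comment> \<open>Diagonal terms are set to 0 so that both variables range over \<open>A\<close>
    and the two sums can be exchanged.\<close>
  let ?S = "\<Sum>a\<in>A. \<Sum>b\<in>A. if a = b then 0 else g a b x"
  have "(\<Sum>b\<in>A - {a}. g a b) x = (\<Sum>b\<in>A. if a = b then 0 else g a b x)" for a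
    unfolding sum_chain_apply using assms(1) by (intro sum.mono_neutral_cong_left) auto
  then have "(\<Sum>a\<in>A. \<Sum>b\<in>A - {a}. g a b) x = ?S"
    by (simp only: sum_chain_apply)
  moreover have "?S = - ?S"
  proof -
    have "?S = (\<Sum>b\<in>A. \<Sum>a\<in>A. if a = b then 0 else g a b x)"
      by (rule sum.swap)
    also have "\<dots> = (\<Sum>b\<in>A. \<Sum>a\<in>A. - (if b = a then 0 else g b a x))"
    proof (intro sum.cong refl)
      fix a b
      show "(if a = b then 0 else g a b x) = - (if b = a then 0 else g b a x)"
        using assms(2)[of b a] by simp
    qed
    finally show ?thesis
      by (simp only: sum_negf)
  qed
  ultimately show "(\<Sum>a\<in>A. \<Sum>b\<in>A - {a}. g a b) x = 0 x"
    by simp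
qed

lemma missing_Cons: "missing I (E \<alpha> # vs) = missing I vs - {\<alpha>}"
  by auto

section \<open>Vanishing of the three compositions on simplices\<close>

lemma weld_htpy_htpy_osimplex:
  assumes "finite I" "distinct vs" "e\<^sub>\<star> \<notin> set vs"
  shows "a\<^sub>\<star> I (a\<^sub>\<star> I (osimplex (e\<^sub>\<star> # vs))) = 0"
proof (cases "card (missing I vs) = 1")
  case True
  with assms show ?thesis
    by (simp add: weld_htpy_osimplex_Star)
next
  case False
  let ?A = "missing I vs" and ?r = "- 1 / real (card I)"
  \<comment> \<open>The exceptional clause of the second \<open>a\<^sub>\<star>\<close> applies when
    two vertices are missing from J. This does not depend on \<alpha>, so the double sum is dropped
    or kept as a whole.\<close>
  have "a\<^sub>\<star> I (osimplex (e\<^sub>\<star> # E \<alpha> # vs)) =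
      (if card ?A = 2 then 0 else ?r \<odot> (\<Sum>\<beta>\<in>?A - {\<alpha>}. osimplex (e\<^sub>\<star> # E \<beta> # E \<alpha> # vs)))"
    if "\<alpha> \<in> ?A" for \<alpha>
  proof -
    have "card (?A - {\<alpha>}) = card ?A - 1" "card ?A \<noteq> 0"
      using that assms(1) by auto
    then have "card (missing I (E \<alpha> # vs)) = 1 \<longleftrightarrow> card ?A = 2"
      unfolding missing_Cons by auto
    moreover have "distinct (E \<alpha> # vs)" "e\<^sub>\<star> \<notin> set (E \<alpha> # vs)"
      using that assms by auto
    ultimately show ?thesis
      by (simp only: weld_htpy_osimplex_Star missing_Cons not_False_eq_True)
  qed
  then have "(\<Sum>\<alpha>\<in>?A. a\<^sub>\<star> I (osimplex (e\<^sub>\<star> # E \<alpha> # vs))) =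
      (if card ?A = 2 then 0 else ?r \<odot> (\<Sum>\<alpha>\<in>?A. \<Sum>\<beta>\<in>?A - {\<alpha>}. osimplex (e\<^sub>\<star> # E \<beta> # E \<alpha> # vs)))"
    by (simp only: chain.scale_sum_right sum.neutral_const split: if_split cong: sum.cong)
       (simp add: chain.scale_sum_right)
  also have "(\<Sum>\<alpha>\<in>?A. \<Sum>\<beta>\<in>?A - {\<alpha>}. osimplex (e\<^sub>\<star> # E \<beta> # E \<alpha> # vs)) = 0"
    by (rule sum_antisym_eq_0) (use assms(1) in simp, rule osimplex_swap_first)
  finally have sum_0: "(\<Sum>\<alpha>\<in>?A. a\<^sub>\<star> I (osimplex (e\<^sub>\<star> # E \<alpha> # vs))) = 0"
    by (simp only: chain.scale_zero_right if_cancel)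
  show ?thesis
    by (simp only: weld_htpy_osimplex_Star[OF assms(2,3)] False if_False chain_maps_scale chain_maps_sum
        fin_supp_sum fin_supp_osimplex sum_0 chain.scale_zero_right)
qed

lemma weld_proj_htpy_osimplex_Star:
  assumes "finite I" "distinct vs" "e\<^sub>\<star> \<notin> set vs"
  shows "p\<^sub>\<star> I (a\<^sub>\<star> I (osimplex (e\<^sub>\<star> # vs))) = 0"
proof (cases "card (missing I vs) = 1")
  case True
  with assms show ?thesis
    by (simp add: weld_htpy_osimplex_Star)
next
  case False
  let ?A = "missing I vs" and ?r = "1 / real (card I)"
  have "p\<^sub>\<star> I (osimplex (e\<^sub>\<star> # E \<alpha> # vs)) = ?r \<odot> (\<Sum>\<beta>\<in>?A - {\<alpha>}. osimplex (E \<beta> # E \<alpha> # vs))"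
    if "\<alpha> \<in> ?A" for \<alpha>
  proof -
    have "distinct (E \<alpha> # vs)" "e\<^sub>\<star> \<notin> set (E \<alpha> # vs)"
      using that assms by auto
    then show ?thesis
      by (simp only: weld_proj_osimplex_Star missing_Cons not_False_eq_True)
  qed
  then have "(\<Sum>\<alpha>\<in>?A. p\<^sub>\<star> I (osimplex (e\<^sub>\<star> # E \<alpha> # vs))) =
      ?r \<odot> (\<Sum>\<alpha>\<in>?A. \<Sum>\<beta>\<in>?A - {\<alpha>}. osimplex (E \<beta> # E \<alpha> # vs))"
    by (simp only: chain.scale_sum_right cong: sum.cong)
  also have "(\<Sum>\<alpha>\<in>?A. \<Sum>\<beta>\<in>?A - {\<alpha>}. osimplex (E \<beta> # E \<alpha> # vs)) = 0"
    by (rule sum_antisym_eq_0) (use assms(1) in simp, rule osimplex_swap_first)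
  finally have sum_0: "(\<Sum>\<alpha>\<in>?A. p\<^sub>\<star> I (osimplex (e\<^sub>\<star> # E \<alpha> # vs))) = 0"
    by (simp only: chain.scale_zero_right if_cancel)
  show ?thesis
    by (simp only: weld_htpy_osimplex_Star[OF assms(2,3)] False if_False chain_maps_scale chain_maps_sum
        fin_supp_sum fin_supp_osimplex sum_0 chain.scale_zero_right)
qed

text \<open>If J contains I, each term of \<open>i\<^sub>\<star>\<close> omits one vertex of I,
  which is then the only missing one, so the exceptional clause of \<open>a\<^sub>\<star>\<close>
  gives 0. Otherwise \<open>i\<^sub>\<star>\<close> fixes J, which \<open>a\<^sub>\<star>\<close>
  kills.\<close>

lemma weld_htpy_incl_osimplex:
  assumes "finite I" "sorted_wrt (<) vs" "e\<^sub>\<star> \<notin> set vs"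
  shows "a\<^sub>\<star> I (i\<^sub>\<star> I (osimplex vs)) = 0"
proof (cases "E ` I \<subseteq> set vs")
  case True
  let ?h = "\<lambda>v ws. if v \<in> E ` I then osimplex (e\<^sub>\<star> # ws) else 0"
  have vs: "distinct vs"
    using assms(2) by (simp add: strict_sorted_iff)
  have "a\<^sub>\<star> I (i\<^sub>\<star> I (osimplex vs)) = face_sum (\<lambda>v ws. a\<^sub>\<star> I (?h v ws)) vs"
    using True vs by (simp only: weld_incl_osimplex if_True) (rule weld_htpy_face_sum, simp)
  also have "\<dots> = face_sum (\<lambda>v ws. 0) vs"
  proof (rule face_sum_cong[OF vs])
    fix v
    assume v: "v \<in> set vs"
    have "missing I vs = {}"
      using True by auto
    then have "card (missing I vs) = 0"
      by (simp only: card.empty)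
    then have "card (missing I (remove1 v vs)) = 1" if "v \<in> E ` I"
      using that card_missing_remove1[OF assms(1) vs v] by simp
    with vs assms(3) show "a\<^sub>\<star> I (?h v (remove1 v vs)) = 0"
      by (simp add: weld_htpy_osimplex_Star)
  qed
  finally show ?thesis
    by (simp only: face_sum_0)
next
  case False
  with assms show ?thesis
    by (simp add: weld_incl_osimplex strict_sorted_iff weld_proj_htpy_osimplex_without_Star)
qed

text \<open>The face J is killed; the other faces carry a minus sign that cancels the one in
  \<open>a\<^sub>\<star>\<close>. On a face omitting v, the summands with \<alpha> in I - J go into
  the first sum, and the summand inserting v itself restores [star, J].\<close>

lemma weld_htpy_boundary_osimplex_Star:
  assumes "finite I" "sorted_wrt (<) vs" "e\<^sub>\<star> \<notin> set vs" "missing I vs \<noteq> {}"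
  shows "a\<^sub>\<star> I (\<partial> (osimplex (e\<^sub>\<star> # vs))) = (1 / real (card I)) \<odot>
    ((\<Sum>\<alpha>\<in>missing I vs. face_sum (\<lambda>v ws. if card (missing I vs) = 1 \<and> v \<notin> E ` I then 0
        else osimplex (e\<^sub>\<star> # E \<alpha> # ws)) vs)
     + real (card {v \<in> set vs. v \<in> E ` I}) \<odot> osimplex (e\<^sub>\<star> # vs))"
proof -
  let ?A = "missing I vs" and ?r = "- 1 / real (card I)"
  let ?d = "\<lambda>\<alpha> v ws. if card ?A = 1 \<and> v \<notin> E ` I then 0 else osimplex (e\<^sub>\<star> # E \<alpha> # ws)"
  let ?s = "\<lambda>v ws. if v \<in> E ` I then osimplex (e\<^sub>\<star> # v # ws) else 0"
  have vs: "distinct vs"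
    using assms(2) by (simp add: strict_sorted_iff)
  have "a\<^sub>\<star> I (\<partial> (osimplex (e\<^sub>\<star> # vs))) = - face_sum (\<lambda>_ ws. a\<^sub>\<star> I (osimplex (e\<^sub>\<star> # ws))) vs"
  \<comment> \<open>If J is empty, the simplex is the star vertex, whose boundary is 0 without
    augmentation, in agreement with the empty face sum.\<close>
  proof (cases "vs = []")
    case False
    with vs assms(3) have "\<partial> (osimplex (e\<^sub>\<star> # vs)) = osimplex vs - face_sum (\<lambda>_ ws. osimplex (e\<^sub>\<star> # ws)) vs"
      by (subst boundary_osimplex) (auto simp: face_sum.simps)
    moreover have "a\<^sub>\<star> I (face_sum (\<lambda>_ ws. osimplex (e\<^sub>\<star> # ws)) vs) = face_sum (\<lambda>_ ws. a\<^sub>\<star> I (osimplex (e\<^sub>\<star> # ws))) vs"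
      by (rule weld_htpy_face_sum) simp
    ultimately show ?thesis
      using assms by (simp add: weld_htpy_diff weld_proj_htpy_osimplex_without_Star)
  qed (simp add: boundary_osimplex)
  also have "face_sum (\<lambda>_ ws. a\<^sub>\<star> I (osimplex (e\<^sub>\<star> # ws))) vs
      = face_sum (\<lambda>v ws. ?r \<odot> ((\<Sum>\<alpha>\<in>?A. ?d \<alpha> v ws) + ?s v ws)) vs"
  proof (rule face_sum_cong[OF vs])
    fix v
    assume v: "v \<in> set vs"
    let ?ws = "remove1 v vs"
    \<comment> \<open>As I - J is nonempty, a face has exactly one missing vertex only if J already
      had just one and \<open>v\<close> is not in I.\<close>
    have "card ?A \<noteq> 0"
      using assms(1,4) by simp
    then have card: "card (missing I ?ws) = 1 \<longleftrightarrow> card ?A = 1 \<and> v \<notin> E ` I"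
      by (simp only: card_missing_remove1[OF assms(1) vs v]) auto
    have sum: "(\<Sum>\<alpha>\<in>missing I ?ws. osimplex (e\<^sub>\<star> # E \<alpha> # ?ws))
        = (\<Sum>\<alpha>\<in>?A. osimplex (e\<^sub>\<star> # E \<alpha> # ?ws)) + ?s v ?ws"
      by (rule sum_missing_remove1[OF assms(1) vs v])
    have htpy: "a\<^sub>\<star> I (osimplex (e\<^sub>\<star> # ?ws)) = (if card (missing I ?ws) = 1 then 0
        else ?r \<odot> (\<Sum>\<alpha>\<in>missing I ?ws. osimplex (e\<^sub>\<star> # E \<alpha> # ?ws)))"
      using vs assms(3) by (intro weld_htpy_osimplex_Star) auto
    show "a\<^sub>\<star> I (osimplex (e\<^sub>\<star> # ?ws)) = ?r \<odot> ((\<Sum>\<alpha>\<in>?A. ?d \<alpha> v ?ws) + ?s v ?ws)"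
    proof (cases "card ?A = 1 \<and> v \<notin> E ` I")
      case True
      have "a\<^sub>\<star> I (osimplex (e\<^sub>\<star> # ?ws)) = 0"
        unfolding htpy by (rule if_P) (use card True in blast)
      moreover have "(\<Sum>\<alpha>\<in>?A. ?d \<alpha> v ?ws) = 0" "?s v ?ws = 0"
        using True by (auto intro: sum.neutral)
      ultimately show ?thesis
        by (simp only: chain.scale_zero_right add_0_left)
    next
      case False
      have "a\<^sub>\<star> I (osimplex (e\<^sub>\<star> # ?ws)) = ?r \<odot> (\<Sum>\<alpha>\<in>missing I ?ws. osimplex (e\<^sub>\<star> # E \<alpha> # ?ws))"
        unfolding htpy by (rule if_not_P) (use card False in blast)
      moreover have "(\<Sum>\<alpha>\<in>?A. ?d \<alpha> v ?ws) = (\<Sum>\<alpha>\<in>?A. osimplex (e\<^sub>\<star> # E \<alpha> # ?ws))"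
        by (intro sum.cong refl if_not_P False)
      ultimately show ?thesis
        by (simp only: sum)
    qed
  qed
  also have "\<dots> = ?r \<odot> ((\<Sum>\<alpha>\<in>?A. face_sum (?d \<alpha>) vs) + face_sum ?s vs)"
    by (simp only: face_sum_scale face_sum_add face_sum_sum)
  also have "face_sum ?s vs = real (card {v \<in> set vs. v \<in> E ` I}) \<odot> osimplex (e\<^sub>\<star> # vs)"
    by (rule face_sum_insert[OF vs, of "\<lambda>ws. osimplex (e\<^sub>\<star> # ws)"]) (rule osimplex_swap_Cons)
  finally show ?thesis
    by (simp only: minus_divide_left[symmetric] chain.scale_minus_left minus_minus)
qed

lemma weld_homotopy_osimplex_Star:
  assumes I: "finite I" and vs: "sorted_wrt (<) vs" "e\<^sub>\<star> \<notin> set vs" and ne: "\<not> E ` I \<subseteq> set vs"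
  shows "\<partial> (a\<^sub>\<star> I (osimplex (e\<^sub>\<star> # vs))) + a\<^sub>\<star> I (\<partial> (osimplex (e\<^sub>\<star> # vs)))
    = osimplex (e\<^sub>\<star> # vs) - i\<^sub>\<star> I (p\<^sub>\<star> I (osimplex (e\<^sub>\<star> # vs)))"
proof -
  define A where "A = missing I vs"
  define N where "N = real (card I)"
  define c where "c = real (card {v \<in> set vs. v \<in> E ` I})"
  define s where "s = osimplex (e\<^sub>\<star> # vs)"
  \<comment> \<open>\<open>d \<alpha>\<close> collects the faces of J behind the star vertex and
    \<alpha>. Thanks to the zero clause it serves both cases: as part of
    \<open>i\<^sub>\<star>\<close> [\<alpha>, J] if |I - J| = 1, and of the boundary of
    [star, \<alpha>, J] otherwise.\<close>
  define d where "d \<alpha> = face_sum (\<lambda>v ws. if card A = 1 \<and> v \<notin> E ` I then 0 else osimplex (e\<^sub>\<star> # E \<alpha> # ws)) vs" for \<alpha>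
  have dist: "distinct vs"
    using vs(1) by (simp add: strict_sorted_iff)
  have A: "finite A" "A \<noteq> {}"
    using I ne by (auto simp: A_def)
  have N: "real (card A) + c = N"
    using card_missing_add_card_present[OF I, of vs] by (simp add: A_def c_def N_def)
  have "N \<noteq> 0"
    using I ne by (auto simp: N_def)
  have ad: "a\<^sub>\<star> I (\<partial> s) = (1 / N) \<odot> ((\<Sum>\<alpha>\<in>A. d \<alpha>) + c \<odot> s)"
    using weld_htpy_boundary_osimplex_Star[OF I vs] A(2) by (simp only: s_def d_def A_def N_def c_def not_False_eq_True)
  have ps: "p\<^sub>\<star> I s = (1 / N) \<odot> (\<Sum>\<alpha>\<in>A. osimplex (E \<alpha> # vs))"
    unfolding s_def A_def N_def by (rule weld_proj_osimplex_Star[OF dist vs(2)])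
  have "\<partial> (a\<^sub>\<star> I s) + a\<^sub>\<star> I (\<partial> s) = s - i\<^sub>\<star> I (p\<^sub>\<star> I s)"
  proof (cases "card A = 1")
    case True
    then obtain \<alpha> where \<alpha>: "A = {\<alpha>}"
      by (auto simp: card_1_singleton_iff)
    then have mem: "\<alpha> \<in> missing I vs"
      by (simp add: A_def)
    then have "E ` I \<subseteq> set (E \<alpha> # vs)" "distinct (E \<alpha> # vs)" "E \<alpha> \<in> E ` I"
      using missing_singleton_iff[OF mem I] True dist by (auto simp: A_def)
    \<comment> \<open>For |I - J| = 1 both conditions single out the vertices in I.\<close>
    moreover have "(if v \<in> E ` I then osimplex (e\<^sub>\<star> # E \<alpha> # ws) else 0)
        = (if card A = 1 \<and> v \<notin> E ` I then 0 else osimplex (e\<^sub>\<star> # E \<alpha> # ws))" for v ws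
      using True by simp
    ultimately have "i\<^sub>\<star> I (osimplex (E \<alpha> # vs)) = s - d \<alpha>"
      by (simp only: weld_incl_osimplex face_sum.simps if_True s_def d_def)
    moreover have "a\<^sub>\<star> I s = 0"
      using True weld_htpy_osimplex_Star[OF dist vs(2), of I] by (simp only: s_def A_def if_True simp_thms)
    \<comment> \<open>The coefficient of \<open>s\<close> balances because 1 + c = N.\<close>
    ultimately show ?thesis
      using N \<open>N \<noteq> 0\<close> True
      by (simp add: ad ps \<alpha> chain_maps_scale) (auto simp: scale_def fun_eq_iff field_simps)
  next
    case False
    \<comment> \<open>The first face drops the star vertex, the second drops \<alpha>, and the
      others make up \<open>d \<alpha>\<close>, whose zero clause is inactive here.\<close>
    have \<partial>: "\<partial> (osimplex (e\<^sub>\<star> # E \<alpha> # vs)) = osimplex (E \<alpha> # vs) - (s - d \<alpha>)"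
      and i: "i\<^sub>\<star> I (osimplex (E \<alpha> # vs)) = osimplex (E \<alpha> # vs)" if "\<alpha> \<in> A" for \<alpha>
    proof -
      have mem: "\<alpha> \<in> missing I vs"
        using that by (simp add: A_def)
      then have "distinct (e\<^sub>\<star> # E \<alpha> # vs)"
        using dist vs(2) by auto
      moreover have "\<not> length (e\<^sub>\<star> # E \<alpha> # vs) \<le> 1"
        by simp
      ultimately show "\<partial> (osimplex (e\<^sub>\<star> # E \<alpha> # vs)) = osimplex (E \<alpha> # vs) - (s - d \<alpha>)"
        using False by (simp only: boundary_osimplex face_sum.simps if_False s_def d_def simp_thms)
      have "\<not> E ` I \<subseteq> set (E \<alpha> # vs)" "distinct (E \<alpha> # vs)"
        using missing_singleton_iff[OF mem I] False mem dist by (auto simp: A_def)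
      then show "i\<^sub>\<star> I (osimplex (E \<alpha> # vs)) = osimplex (E \<alpha> # vs)"
        by (simp only: weld_incl_osimplex if_False)
    qed
    have as: "a\<^sub>\<star> I s = (- 1 / N) \<odot> (\<Sum>\<alpha>\<in>A. osimplex (e\<^sub>\<star> # E \<alpha> # vs))"
      using False weld_htpy_osimplex_Star[OF dist vs(2), of I] by (simp only: s_def A_def N_def if_False)
    have "\<partial> (a\<^sub>\<star> I s) = (- 1 / N) \<odot> (\<Sum>\<alpha>\<in>A. osimplex (E \<alpha> # vs) - (s - d \<alpha>))"
      by (simp only: as \<partial> chain_maps_scale chain_maps_sum fin_supp_sum fin_supp_osimplex cong: sum.cong)
    moreover have "i\<^sub>\<star> I (p\<^sub>\<star> I s) = (1 / N) \<odot> (\<Sum>\<alpha>\<in>A. osimplex (E \<alpha> # vs))"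
      by (simp only: ps i chain_maps_scale chain_maps_sum fin_supp_sum fin_supp_osimplex cong: sum.cong)
    \<comment> \<open>The \<open>d\<close> terms cancel, and \<open>s\<close> gets the coefficient
      (card A + c) / N = 1.\<close>
    ultimately show ?thesis
      using N \<open>N \<noteq> 0\<close>
      by (auto simp: ad fun_eq_iff scale_def sum_chain_apply sum_subtractf sum.distrib field_simps)
  qed
  then show ?thesis
    by (simp only: s_def)
qed


section \<open>The chain maps\<close>

lemma in_std_simplex_iff: "X \<in> \<Delta> n \<longleftrightarrow> X \<noteq> {} \<and> X \<subseteq> E ` {0..n}"
  unfolding std_simplex_def by (auto simp: subset_image_iff)

text \<open>The star vertex is not one of the vertices of I, so both families of simplices obey the
  same condition of not containing I; nonemptiness of X admits the star vertex alone.\<close>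

lemma in_stellar_iff:
  "X \<in> stellar I n \<longleftrightarrow> X \<noteq> {} \<and> X \<subseteq> insert e\<^sub>\<star> (E ` {0..n}) \<and> \<not> E ` I \<subseteq> X" (is "_ \<longleftrightarrow> ?R")
proof
  assume "X \<in> stellar I n"
  then show ?R
    unfolding stellar_def by auto
next
  assume R: ?R
  then obtain J where J: "X - {e\<^sub>\<star>} = E ` J" "J \<subseteq> {0..n}"
    by (metis subset_image_iff Diff_subset_conv insert_is_Un)
  show "X \<in> stellar I n"
  proof (cases "e\<^sub>\<star> \<in> X")
    case True
    with J have "X = insert e\<^sub>\<star> (E ` J)"
      by auto
    with J R show ?thesis
      unfolding stellar_def by blast
  next
    case False
    with J have "X = E ` J"
      by auto
    with J R show ?thesis
      unfolding stellar_def by blast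
  qed
qed

text \<open>The star vertex is least, so an increasing list can contain it only as its head; this
  leaves two kinds of simplices.\<close>

lemma ochains_stellar_induct [consumes 1, case_names zero add scale simplex star]:
  assumes c: "c \<in> ochains l (stellar I n)"
    and zero: "P 0"
    and add: "\<And>c d. fin_supp c \<Longrightarrow> fin_supp d \<Longrightarrow> P c \<Longrightarrow> P d \<Longrightarrow> P (c + d)"
    and scale: "\<And>r c. fin_supp c \<Longrightarrow> P c \<Longrightarrow> P (r \<odot> c)"
    and simplex: "\<And>vs. sorted_wrt (<) vs \<Longrightarrow> e\<^sub>\<star> \<notin> set vs \<Longrightarrow> length vs = l + 1 \<Longrightarrow>
      set vs \<subseteq> E ` {0..n} \<Longrightarrow> \<not> E ` I \<subseteq> set vs \<Longrightarrow> P (osimplex vs)"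
    and star: "\<And>vs. sorted_wrt (<) vs \<Longrightarrow> e\<^sub>\<star> \<notin> set vs \<Longrightarrow> length vs = l \<Longrightarrow>
      set vs \<subseteq> E ` {0..n} \<Longrightarrow> \<not> E ` I \<subseteq> set vs \<Longrightarrow> P (osimplex (e\<^sub>\<star> # vs))"
  shows "P c"
  using c
proof (induction rule: ochains_induct)
  case zero
  show ?case by (rule assms)
next
  case (add c d)
  then show ?case by (intro assms(3)) (auto simp: ochains_fin_supp)
next
  case (scale r c)
  then show ?case by (intro assms(4)) (auto simp: ochains_fin_supp)
next
  case (osimplex vs)
  then obtain v ws where vs: "vs = v # ws"
    by (cases vs) auto
  then have ws: "e\<^sub>\<star> \<notin> set ws"
    using osimplex(1) by (auto simp: less_vertex_def)
  show ?case
  proof (cases v)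
    case Star
    with osimplex vs ws show ?thesis
      by (auto simp: in_stellar_iff intro!: assms(6))
  next
    case (E i)
    with osimplex vs ws show ?thesis
      by (intro assms(5)) (auto simp: in_stellar_iff)
  qed
qed

section \<open>The maps respect the chain groups\<close>

lemma weld_incl_ochains:
  assumes "c \<in> ochains l (\<Delta> n)" "I \<subseteq> {0..n}"
  shows "i\<^sub>\<star> I c \<in> ochains l (stellar I n)"
  using assms(1)
proof (induction rule: ochains_induct)
  case (osimplex vs)
  then have vs: "distinct vs" "set vs \<subseteq> E ` {0..n}" "vs \<noteq> []" "length vs = l + 1"
    by (auto simp: in_std_simplex_iff strict_sorted_iff)
  show ?case
  proof (cases "E ` I \<subseteq> set vs")
    case True
    have "(if v \<in> E ` I then osimplex (e\<^sub>\<star> # remove1 v vs) else 0) \<in> ochains l (stellar I n)"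
      if "v \<in> set vs" for v
    proof (cases "v \<in> E ` I")
      case True
      \<comment> \<open>Omitting \<open>v\<close>, a vertex of I, leaves a set not containing I; the
        star vertex replaces \<open>v\<close>, so the degree is unchanged.\<close>
      have "set (remove1 v vs) = set vs - {v}"
        using vs(1) by simp
      with True vs(2) have "set (e\<^sub>\<star> # remove1 v vs) \<in> stellar I n"
        unfolding in_stellar_iff by auto
      moreover have "e\<^sub>\<star> \<notin> set vs"
        using vs(2) by auto
      ultimately have "osimplex (e\<^sub>\<star> # remove1 v vs) \<in> ochains l (stellar I n)"
        using vs that by (intro osimplex_in_ochains) (auto simp: length_remove1)
      with True show ?thesis
        by simp
    qed (simp add: ochains_0)
    with True vs(1) show ?thesis
      by (simp only: weld_incl_osimplex if_True) (rule face_sum_in_ochains, auto)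
  next
    case False
    have "set vs \<in> stellar I n"
      unfolding in_stellar_iff using vs(2,3) False by blast
    with vs False show ?thesis
      by (simp only: weld_incl_osimplex if_False) (rule osimplex_in_ochains)
  qed
qed (auto simp only: chain_maps_0 chain_maps_add chain_maps_scale ochains_0 ochains_fin_supp intro!: ochains_add ochains_scale)

lemma weld_proj_ochains:
  assumes "c \<in> ochains l (stellar I n)" "I \<subseteq> {0..n}"
  shows "p\<^sub>\<star> I c \<in> ochains l (\<Delta> n)"
  using assms(1)
proof (induction rule: ochains_stellar_induct)
  case (simplex vs)
  then show ?case
    by (auto simp: weld_proj_htpy_osimplex_without_Star in_std_simplex_iff strict_sorted_iff intro!: osimplex_in_ochains)
next
  case (star vs)
  then have "distinct vs"
    by (simp add: strict_sorted_iff)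
  with star assms(2) show ?case
    by (auto simp: weld_proj_osimplex_Star in_std_simplex_iff
        intro!: osimplex_in_ochains ochains_scale ochains_sum)
qed (auto simp only: chain_maps_0 chain_maps_add chain_maps_scale ochains_0 intro!: ochains_add ochains_scale)

text \<open>This is the reason for the exceptional clause: for \<alpha> in I - J,
  [star, \<alpha>, J] is a simplex of the subdivision only if |I - J| is not 1.\<close>

lemma weld_htpy_ochains:
  assumes "c \<in> ochains l (stellar I n)" "I \<subseteq> {0..n}"
  shows "a\<^sub>\<star> I c \<in> ochains (l + 1) (stellar I n)"
  using assms(1)
proof (induction rule: ochains_stellar_induct)
  case (simplex vs)
  then show ?case
    by (simp only: weld_proj_htpy_osimplex_without_Star ochains_0 not_False_eq_True)
next
  case (star vs)
  then have vs: "distinct vs"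
    by (simp add: strict_sorted_iff)
  have fin: "finite I"
    using assms(2) finite_subset by blast
  show ?case
  proof (cases "card (missing I vs) = 1")
    case False
    have "osimplex (e\<^sub>\<star> # E \<alpha> # vs) \<in> ochains (l + 1) (stellar I n)" if \<alpha>: "\<alpha> \<in> missing I vs" for \<alpha>
    proof (rule osimplex_in_ochains)
      have "\<not> E ` I \<subseteq> set (E \<alpha> # vs)"
        using missing_singleton_iff[OF \<alpha> fin] False by simp
      then have "\<not> E ` I \<subseteq> set (e\<^sub>\<star> # E \<alpha> # vs)"
        by auto
      moreover have "\<alpha> \<in> {0..n}"
        using \<alpha> assms(2) by auto
      ultimately show "set (e\<^sub>\<star> # E \<alpha> # vs) \<in> stellar I n"
        using star(4) unfolding in_stellar_iff by auto
    qed (use \<alpha> star vs in auto)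
    with False show ?thesis
      unfolding weld_htpy_osimplex_Star[OF vs star(2)]
      by (simp only: if_False) (intro ochains_scale ochains_sum)
  next
    case True
    then show ?thesis
      unfolding weld_htpy_osimplex_Star[OF vs star(2)] by (simp only: if_True simp_thms ochains_0)
  qed
qed (auto simp only: chain_maps_0 chain_maps_add chain_maps_scale ochains_0 intro!: ochains_add ochains_scale)

section \<open>The identities on all chains\<close>

lemma weld_homotopy:
  assumes "c \<in> ochains l (stellar I n)" "finite I"
  shows "\<partial> (a\<^sub>\<star> I c) + a\<^sub>\<star> I (\<partial> c) = c - i\<^sub>\<star> I (p\<^sub>\<star> I c)"
  using assms(1)
proof (induction rule: ochains_stellar_induct)
  case (add c d)
  have "\<partial> (a\<^sub>\<star> I (c + d)) + a\<^sub>\<star> I (\<partial> (c + d)) = (\<partial> (a\<^sub>\<star> I c) + a\<^sub>\<star> I (\<partial> c)) + (\<partial> (a\<^sub>\<star> I d) + a\<^sub>\<star> I (\<partial> d))"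
    using add(1,2) by (simp only: chain_maps_add fin_supp_boundary fin_supp_weld_htpy) (simp only: ac_simps)
  also have "\<dots> = (c + d) - (i\<^sub>\<star> I (p\<^sub>\<star> I c) + i\<^sub>\<star> I (p\<^sub>\<star> I d))"
    unfolding add by (simp only: algebra_simps)
  finally show ?case
    using add(1,2) by (simp only: chain_maps_add fin_supp_weld_proj)
next
  case (scale r c)
  have "\<partial> (a\<^sub>\<star> I (r \<odot> c)) + a\<^sub>\<star> I (\<partial> (r \<odot> c)) = r \<odot> (\<partial> (a\<^sub>\<star> I c) + a\<^sub>\<star> I (\<partial> c))"
    using scale(1) by (simp only: chain_maps_scale fin_supp_boundary fin_supp_weld_htpy chain.scale_right_distrib)
  also have "\<dots> = r \<odot> c - r \<odot> i\<^sub>\<star> I (p\<^sub>\<star> I c)"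
    unfolding scale by (simp only: chain.scale_right_diff_distrib)
  finally show ?case
    using scale(1) by (simp only: chain_maps_scale fin_supp_weld_proj)
next
  case (simplex vs)
  have vs: "distinct vs"
    using simplex(1) by (simp add: strict_sorted_iff)
  \<comment> \<open>Without the star vertex, \<open>a\<^sub>\<star>\<close> kills the simplex and
    its faces, while \<open>p\<^sub>\<star>\<close> and \<open>i\<^sub>\<star>\<close> fix the
    simplex; both sides are 0.\<close>
  have "a\<^sub>\<star> I (\<partial> (osimplex vs)) = 0"
  proof (cases "length vs \<le> 1")
    case False
    have "a\<^sub>\<star> I (face_sum (\<lambda>_. osimplex) vs) = face_sum (\<lambda>_ ws. a\<^sub>\<star> I (osimplex ws)) vs"
      by (rule weld_htpy_face_sum) simp
    also have "\<dots> = face_sum (\<lambda>_ _. 0) vs"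
    proof (rule face_sum_cong[OF vs])
      fix v
      have "sorted_wrt (<) (remove1 v vs)" "e\<^sub>\<star> \<notin> set (remove1 v vs)"
        using simplex(1,2) vs by (auto simp: strict_sorted_iff sorted_remove1)
      then show "a\<^sub>\<star> I (osimplex (remove1 v vs)) = 0"
        by (rule weld_proj_htpy_osimplex_without_Star)
    qed
    finally show ?thesis
      using False by (simp only: boundary_osimplex[OF vs] face_sum_0 if_False)
  qed (simp add: boundary_osimplex[OF vs])
  moreover have "i\<^sub>\<star> I (osimplex vs) = osimplex vs"
    using simplex(5) by (simp only: weld_incl_osimplex[OF vs] if_False)
  ultimately show ?case
    by (simp only: weld_proj_htpy_osimplex_without_Star[OF simplex(1,2)] chain_maps_0 add_0_left diff_self)
next
  case (star vs)
  show ?case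
    by (rule weld_homotopy_osimplex_Star[OF assms(2) star(1,2,5)])
qed (simp only: chain_maps_0 add_0_left diff_self)

lemma weld_htpy_htpy:
  assumes "c \<in> ochains l (stellar I n)" "finite I"
  shows "a\<^sub>\<star> I (a\<^sub>\<star> I c) = 0"
  using assms(1)
proof (induction rule: ochains_stellar_induct)
  case (star vs)
  then show ?case
    by (intro weld_htpy_htpy_osimplex assms(2)) (auto simp: strict_sorted_iff)
qed (simp_all only: chain_maps_0 chain_maps_add chain_maps_scale fin_supp_weld_htpy weld_proj_htpy_osimplex_without_Star
    not_False_eq_True add_0_left chain.scale_zero_right)

lemma weld_proj_htpy:
  assumes "c \<in> ochains l (stellar I n)" "finite I"
  shows "p\<^sub>\<star> I (a\<^sub>\<star> I c) = 0"
  using assms(1)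
proof (induction rule: ochains_stellar_induct)
  case (star vs)
  then show ?case
    by (intro weld_proj_htpy_osimplex_Star assms(2)) (auto simp: strict_sorted_iff)
qed (simp_all only: chain_maps_0 chain_maps_add chain_maps_scale fin_supp_weld_htpy weld_proj_htpy_osimplex_without_Star
    not_False_eq_True add_0_left chain.scale_zero_right)

lemma weld_htpy_incl:
  assumes "c \<in> ochains l (\<Delta> n)" "finite I"
  shows "a\<^sub>\<star> I (i\<^sub>\<star> I c) = 0"
  using assms(1)
proof (induction rule: ochains_induct)
  case (osimplex vs)
  then show ?case
    by (intro weld_htpy_incl_osimplex assms(2)) (auto simp: in_std_simplex_iff)
qed (simp_all only: chain_maps_0 chain_maps_add chain_maps_scale ochains_fin_supp fin_supp_weld_incl
    add_0_left chain.scale_zero_right)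

theorem mainTheorem6:
  fixes n k :: nat and I :: "nat set"
  assumes "k \<le> n" and "I \<subseteq> {0..n}" and "card I = k + 1"
  shows
    "(\<forall>l. i\<^sub>\<star> I ` ochains l (\<Delta> n) \<subseteq> ochains l (stellar I n)) \<and>
     (\<forall>l. p\<^sub>\<star> I ` ochains l (stellar I n) \<subseteq> ochains l (\<Delta> n)) \<and>
     (\<forall>l. a\<^sub>\<star> I ` ochains l (stellar I n) \<subseteq> ochains (l + 1) (stellar I n)) \<and>
     (\<forall>l. \<forall>c \<in> ochains l (stellar I n). \<partial> (a\<^sub>\<star> I c) + a\<^sub>\<star> I (\<partial> c) = c - i\<^sub>\<star> I (p\<^sub>\<star> I c)) \<and>
     (\<forall>l. \<forall>c \<in> ochains l (stellar I n). a\<^sub>\<star> I (a\<^sub>\<star> I c) = 0) \<and>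
     (\<forall>l. \<forall>c \<in> ochains l (\<Delta> n). a\<^sub>\<star> I (i\<^sub>\<star> I c) = 0) \<and>
     (\<forall>l. \<forall>c \<in> ochains l (stellar I n). p\<^sub>\<star> I (a\<^sub>\<star> I c) = 0)"
proof -
  have "finite I"
    using assms(2) finite_subset by blast
  then show ?thesis
    using assms(2)
    by (auto intro: weld_incl_ochains weld_proj_ochains weld_htpy_ochains[unfolded Suc_eq_plus1[symmetric]]
        weld_homotopy weld_htpy_htpy weld_htpy_incl weld_proj_htpy)
qed

end
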